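(* Let $N\in{}^*\mathbb{N}\setminus\mathbb{N}$, let $\Omega=\{0,\tfrac1N,\dots,\tfrac iN,\dots,\tfrac NN\}$, let $A\subseteq[0,1]$, let $0<s\le 1$, and let $H^s(A)$ be the Hausdorff $s$-dimensional outer measure of $A$. Then: (a) for every positive infinitesimal $\delta\in{}^*\mathbb{R}$, $$H^s(A)\le \inf\{\operatorname{st} h^s_\delta(B) : B\subseteq\Omega \text{ internal},\ B\supseteq \operatorname{st}^{-1}(A)\};$$ (b) $$H^s(A)=\lim_{\delta\to 0}\ \inf\{\operatorname{st} h^s_\delta(B) : B\subseteq\Omega \text{ internal},\ B\supseteq \operatorname{st}^{-1}(A)\},$$ where in the limit $\delta$ ranges over standard positive real values. In particular, the nonstandard expression for $H^s(A)$ in (b) does not depend on the choice of $N$.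
   Context: The nonstandard universe ${}^*\mathscr{V}$ is the ultrapower of the standard universe $\mathscr{V}=\langle V,\in\rangle$ by a nonprincipal ultrafilter on $\mathbb{N}$; internal sets are those represented by sequences of standard sets, and the Łoś transfer principle, overspill and $\aleph_1$-saturation (any countable sequence of internal sets with the finite intersection property has nonempty intersection) hold. For finite $x\in{}^*\mathbb{R}$, $\operatorname{st}(x)$ is the unique real number infinitely close to $x$; for infinite positive $x$ put $\operatorname{st}(x)=+\infty$. For $A\subseteq[0,1]$, $\operatorname{st}^{-1}(A)=\{x\in\Omega:\operatorname{st}(x)\in A\}$ (in general not internal). Hausdorff outer measure: for $s>0$ and real $\delta>0$, $H^s_\delta(A)=\inf\sum_{i}\operatorname{diam}(U_i)^s$, the infimum being over all countable covers $\{U_i\}_{i\in\mathbb{N}}$ of $A$ with $0\le\operatorname{diam}(U_i)\le\delta$ for all $i$; and $H^s(A)=\lim_{\delta\to0}H^s_\delta(A)=\sup_{\delta>0}H^s_\delta(A)\in[0,\infty]$. Discrete measure: for $\delta>0$ in ${}^*\mathbb{R}$, a $\delta$-interval of $\Omega$ is a set $\{i/N,(i+1)/N,\dots,j/N\}\subseteq\Omega$ whose (discrete) diameter, defined to be $(j-i+1)/N$, is $\le\delta$. For an internal set $B\subseteq\Omega$, $$h^s_\delta(B)=\min\sum_{i=1}^{L}(\operatorname{diam}(V_i))^s,$$ where the minimum is taken, internally, over all (internal, hyperfinite) partitions $\{V_1,\dots,V_L\}$ of $B$ into $\delta$-intervals; $L\in{}^*\mathbb{N}$ depends on the partition, and $\operatorname{diam}(V_i)$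 is the discrete diameter just defined. If no such partition exists, the minimum is taken to be $+\infty$. *)

theory Defs
  imports "HOL-Analysis.Analysis"
begin

section \<open>Ultrapowers over the natural numbers\<close>

text \<open>Ultrafilters are kept as a parameter \<open>U\<close>, so the elements of the ultrapower of a type are
  equivalence classes of sequences in a carrier set \<open>hyper U\<close> rather than a type of their own.\<close>

definition nonprincipal_ultrafilter :: "nat filter \<Rightarrow> bool" where
  "nonprincipal_ultrafilter U \<longleftrightarrow>
     U \<noteq> bot \<and>
     (\<forall>P. eventually P U \<or> eventually (\<lambda>n. \<not> P n) U) \<and>
     (\<forall>n. U \<noteq> principal {n})"

type_synonym 'a hyp = "(nat \<Rightarrow> 'a) set"

definition hclass :: "nat filter \<Rightarrow> (nat \<Rightarrow> 'a) \<Rightarrow> 'a hyp" where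
  "hclass U x = {y. \<forall>\<^sub>F n in U. y n = x n}"

definition hyper :: "nat filter \<Rightarrow> 'a hyp set" where
  "hyper U = range (hclass U)"

definition hstd :: "nat filter \<Rightarrow> 'a \<Rightarrow> 'a hyp" where
  "hstd U c = hclass U (\<lambda>_. c)"

text \<open>Application of an internal function; with \<open>hstd\<close> in function position it yields the
  nonstandard extension of a standard (curried) function.\<close>

definition happ :: "nat filter \<Rightarrow> ('a \<Rightarrow> 'b) hyp \<Rightarrow> 'a hyp \<Rightarrow> 'b hyp" where
  "happ U F X = {y. \<exists>f\<in>F. \<exists>x\<in>X. \<forall>\<^sub>F n in U. y n = f n (x n)}"

definition hrel :: "nat filter \<Rightarrow> ('a \<Rightarrow> 'b \<Rightarrow> bool) \<Rightarrow> 'a hyp \<Rightarrow> 'b hyp \<Rightarrow> bool" where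
  "hrel U R X Y \<longleftrightarrow> (\<exists>x\<in>X. \<exists>y\<in>Y. \<forall>\<^sub>F n in U. R (x n) (y n))"

abbreviation hle :: "nat filter \<Rightarrow> 'a::ord hyp \<Rightarrow> 'a hyp \<Rightarrow> bool" where
  "hle U \<equiv> hrel U (\<le>)"

abbreviation hless :: "nat filter \<Rightarrow> 'a::ord hyp \<Rightarrow> 'a hyp \<Rightarrow> bool" where
  "hless U \<equiv> hrel U (<)"

text \<open>An internal set is an element \<open>B\<close> of \<open>hyper U\<close> at a set type; \<open>hext U B\<close> is the external
  set of its members.\<close>

definition hext :: "nat filter \<Rightarrow> 'a set hyp \<Rightarrow> 'a hyp set" where
  "hext U B = {x \<in> hyper U. hrel U (\<in>) x B}"

lemma hclass_self [simp]: "x \<in> hclass U x"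
  by (simp add: hclass_def)

lemma hclass_eq_iff: "hclass U x = hclass U y \<longleftrightarrow> (\<forall>\<^sub>F n in U. x n = y n)"
proof
  assume "hclass U x = hclass U y"
  then have "x \<in> hclass U y" by (metis hclass_self)
  then show "\<forall>\<^sub>F n in U. x n = y n" by (simp add: hclass_def)
next
  assume *: "\<forall>\<^sub>F n in U. x n = y n"
  have "(\<forall>\<^sub>F n in U. z n = x n) \<longleftrightarrow> (\<forall>\<^sub>F n in U. z n = y n)" for z
    by (rule eventually_cong[OF *]) simp
  then show "hclass U x = hclass U y" by (simp add: hclass_def)
qed

lemma happ_hclass: "happ U (hclass U f) (hclass U x) = hclass U (\<lambda>n. f n (x n))"
proof (intro set_eqI iffI)
  fix y assume "y \<in> happ U (hclass U f) (hclass U x)"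
  then obtain g z where "\<forall>\<^sub>F n in U. g n = f n" "\<forall>\<^sub>F n in U. z n = x n"
    "\<forall>\<^sub>F n in U. y n = g n (z n)"
    by (auto simp: happ_def hclass_def)
  then have "\<forall>\<^sub>F n in U. y n = f n (x n)" by eventually_elim simp
  then show "y \<in> hclass U (\<lambda>n. f n (x n))" by (simp add: hclass_def)
next
  fix y assume "y \<in> hclass U (\<lambda>n. f n (x n))"
  then have "\<forall>\<^sub>F n in U. y n = f n (x n)" by (simp add: hclass_def)
  then show "y \<in> happ U (hclass U f) (hclass U x)"
    unfolding happ_def by (intro CollectI bexI[of _ f] bexI[of _ x]) auto
qed

lemma hrel_hclass: "hrel U R (hclass U x) (hclass U y) \<longleftrightarrow> (\<forall>\<^sub>F n in U. R (x n) (y n))"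
proof
  assume "hrel U R (hclass U x) (hclass U y)"
  then obtain a b where "\<forall>\<^sub>F n in U. a n = x n" "\<forall>\<^sub>F n in U. b n = y n"
    "\<forall>\<^sub>F n in U. R (a n) (b n)"
    by (auto simp: hrel_def hclass_def)
  then show "\<forall>\<^sub>F n in U. R (x n) (y n)" by eventually_elim simp
next
  assume "\<forall>\<^sub>F n in U. R (x n) (y n)"
  then show "hrel U R (hclass U x) (hclass U y)"
    unfolding hrel_def by (intro bexI[of _ x] bexI[of _ y]) auto
qed

lemma hyperE:
  assumes "X \<in> hyper U"
  obtains x where "X = hclass U x"
  using assms by (auto simp: hyper_def)

lemma hclass_in_hyper [simp]: "hclass U x \<in> hyper U"
  by (simp add: hyper_def)

lemma hclass_in_hext: "hclass U x \<in> hext U (hclass U B) \<longleftrightarrow> (\<forall>\<^sub>F n in U. x n \<in> B n)"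
  by (simp add: hext_def hrel_hclass)


section \<open>Infinitesimals and standard parts\<close>

definition infinitesimal :: "nat filter \<Rightarrow> real hyp \<Rightarrow> bool" where
  "infinitesimal U x \<longleftrightarrow>
     (\<forall>e>0. hless U (happ U (hstd U abs) x) (hstd U e))"

text \<open>The discrete measure may take the value \<open>\<infinity>\<close> internally, so standard parts are
  taken of extended hyperreals; \<open>hereal\<close> embeds the hyperreals into these.\<close>

definition hereal :: "nat filter \<Rightarrow> real hyp \<Rightarrow> ereal hyp" where
  "hereal U x = happ U (hstd U ereal) x"

definition inf_close :: "nat filter \<Rightarrow> ereal hyp \<Rightarrow> real \<Rightarrow> bool" where
  "inf_close U x r \<longleftrightarrow>
     (\<forall>e>0. hless U (happ U (hstd U (\<lambda>t. \<bar>t - ereal r\<bar>)) x) (hstd U (ereal e)))"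

definition st :: "nat filter \<Rightarrow> ereal hyp \<Rightarrow> ereal" where
  "st U x =
     (if \<exists>r. inf_close U x r then ereal (THE r. inf_close U x r)
      else if \<forall>K::real. hless U (hstd U (ereal K)) x then \<infinity>
      else -\<infinity>)"

lemma inf_close_unique:
  assumes "nonprincipal_ultrafilter U" "x \<in> hyper U" "inf_close U x r" "inf_close U x r'"
  shows "r = r'"
proof (rule ccontr)
  assume "r \<noteq> r'"
  define e where "e = \<bar>r - r'\<bar> / 2"
  have e: "e > 0" using \<open>r \<noteq> r'\<close> by (simp add: e_def)
  obtain y where y: "x = hclass U y" using assms(2) by (rule hyperE)
  have "\<forall>\<^sub>F n in U. \<bar>y n - ereal r\<bar> < ereal e" "\<forall>\<^sub>F n in U. \<bar>y n - ereal r'\<bar> < ereal e"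
    using assms(3,4) e by (simp_all add: inf_close_def y hstd_def happ_hclass hrel_hclass)
  then have "\<forall>\<^sub>F n in U. False"
  proof eventually_elim
    case (elim n)
    then show False by (cases "y n") (auto simp: e_def abs_real_def split: if_splits)
  qed
  then show False
    using assms(1) by (simp add: nonprincipal_ultrafilter_def trivial_limit_def)
qed


section \<open>Hausdorff outer measure\<close>

text \<open>Boundedness is required because \<open>diameter\<close> is not meaningful for unbounded
  sets. Empty covering sets contribute \<open>0\<close>, as \<open>0 powr s = 0\<close>.\<close>

definition hausdorff_delta :: "real \<Rightarrow> real \<Rightarrow> 'a::metric_space set \<Rightarrow> ereal" where
  "hausdorff_delta s \<delta> A =
     Inf {(\<Sum>i. ereal (diameter (C i) powr s)) | C :: nat \<Rightarrow> 'a set.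
            A \<subseteq> (\<Union>i. C i) \<and> (\<forall>i. bounded (C i) \<and> diameter (C i) \<le> \<delta>)}"

definition hausdorff_outer :: "real \<Rightarrow> 'a::metric_space set \<Rightarrow> ereal" where
  "hausdorff_outer s A = (SUP \<delta>\<in>{0<..}. hausdorff_delta s \<delta> A)"


section \<open>The discrete measure on a grid\<close>

definition grid_interval :: "nat \<Rightarrow> nat \<Rightarrow> nat \<Rightarrow> real set" where
  "grid_interval N i j = (\<lambda>k. real k / real N) ` {i..j}"

definition grid :: "nat \<Rightarrow> real set" where
  "grid N = grid_interval N 0 N"

text \<open>The discrete diameter of \<open>{i/N, \<dots>, j/N}\<close> is \<open>(j - i + 1)/N\<close>; the numerator
  is the number of points, see \<open>ddiam_grid_interval\<close>.\<close>

definition ddiam :: "nat \<Rightarrow> real set \<Rightarrow> real" where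
  "ddiam N V = real (card V) / real N"

lemma ddiam_grid_interval:
  assumes "N > 0" "i \<le> j"
  shows "ddiam N (grid_interval N i j) = (real j - real i + 1) / real N"
proof -
  have "inj_on (\<lambda>k. real k / real N) {i..j}"
    using assms(1) by (auto simp: inj_on_def)
  then show ?thesis
    using assms(2) by (simp add: ddiam_def grid_interval_def card_image of_nat_diff)
qed

definition delta_interval :: "nat \<Rightarrow> real \<Rightarrow> real set \<Rightarrow> bool" where
  "delta_interval N \<delta> V \<longleftrightarrow>
     (\<exists>i j. i \<le> j \<and> j \<le> N \<and> V = grid_interval N i j) \<and> ddiam N V \<le> \<delta>"

definition delta_partitions :: "nat \<Rightarrow> real \<Rightarrow> real set \<Rightarrow> real set set set" where
  "delta_partitions N \<delta> B = {P. partition_on B P \<and> (\<forall>V\<in>P. delta_interval N \<delta> V)}"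

definition partition_sum :: "real \<Rightarrow> nat \<Rightarrow> real set set \<Rightarrow> real" where
  "partition_sum s N P = (\<Sum>V\<in>P. ddiam N V powr s)"

definition discrete_h :: "real \<Rightarrow> nat \<Rightarrow> real \<Rightarrow> real set \<Rightarrow> ereal" where
  "discrete_h s N \<delta> B =
     (if delta_partitions N \<delta> B = {} then \<infinity>
      else ereal (Min (partition_sum s N ` delta_partitions N \<delta> B)))"

lemma finite_delta_partitions: "finite (delta_partitions N \<delta> B)"
proof (rule finite_subset)
  show "delta_partitions N \<delta> B \<subseteq> Pow (Pow (grid N))"
    by (fastforce simp: delta_partitions_def delta_interval_def grid_def grid_interval_def)
qed (simp add: grid_def grid_interval_def)

text \<open>The minimum over all internal hyperfinite partitions: by transfer it is computed by the
  nonstandard extension of \<open>discrete_h s\<close>; \<open>hdiscrete_h_is_min\<close> spells this out.\<close>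

definition hdiscrete_h ::
  "nat filter \<Rightarrow> real \<Rightarrow> nat hyp \<Rightarrow> real hyp \<Rightarrow> real set hyp \<Rightarrow> ereal hyp" where
  "hdiscrete_h U s N \<delta> B = happ U (happ U (happ U (hstd U (discrete_h s)) N) \<delta>) B"

definition hdelta_partitions ::
  "nat filter \<Rightarrow> nat hyp \<Rightarrow> real hyp \<Rightarrow> real set hyp \<Rightarrow> real set set hyp set" where
  "hdelta_partitions U N \<delta> B =
     hext U (happ U (happ U (happ U (hstd U delta_partitions) N) \<delta>) B)"

definition hpartition_sum ::
  "nat filter \<Rightarrow> real \<Rightarrow> nat hyp \<Rightarrow> real set set hyp \<Rightarrow> real hyp" where
  "hpartition_sum U s N P = happ U (happ U (hstd U (partition_sum s)) N) P"

lemma hdiscrete_h_is_min: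
  assumes U: "nonprincipal_ultrafilter U"
    and "N \<in> hyper U" "\<delta> \<in> hyper U" "B \<in> hyper U"
  shows "if hdelta_partitions U N \<delta> B = {} then hdiscrete_h U s N \<delta> B = hstd U \<infinity>
         else \<exists>P\<in>hdelta_partitions U N \<delta> B.
                hdiscrete_h U s N \<delta> B = hereal U (hpartition_sum U s N P) \<and>
                (\<forall>Q\<in>hdelta_partitions U N \<delta> B.
                   hle U (hpartition_sum U s N P) (hpartition_sum U s N Q))"
proof -
  obtain n d b where eqs: "N = hclass U n" "\<delta> = hclass U d" "B = hclass U b"
    using assms(2-4) by (metis hyperE)
  let ?D = "\<lambda>k. delta_partitions (n k) (d k) (b k)"
  have D: "hclass U p \<in> hdelta_partitions U N \<delta> B \<longleftrightarrow> (\<forall>\<^sub>F k in U. p k \<in> ?D k)" for p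
    by (simp add: hdelta_partitions_def eqs hstd_def happ_hclass hclass_in_hext)
  have H: "hdiscrete_h U s N \<delta> B = hclass U (\<lambda>k. discrete_h s (n k) (d k) (b k))"
    by (simp add: hdiscrete_h_def eqs hstd_def happ_hclass)
  have S: "hpartition_sum U s N (hclass U p) = hclass U (\<lambda>k. partition_sum s (n k) (p k))" for p
    by (simp add: hpartition_sum_def eqs hstd_def happ_hclass)
  define m where "m k = arg_min_on (partition_sum s (n k)) (?D k)" for k
  have m: "m k \<in> ?D k" "\<And>q. q \<in> ?D k \<Longrightarrow> partition_sum s (n k) (m k) \<le> partition_sum s (n k) q"
    if "?D k \<noteq> {}" for k
    using that arg_min_if_finite(1) arg_min_least finite_delta_partitions m_def by metis+
  have hm: "discrete_h s (n k) (d k) (b k) = ereal (partition_sum s (n k) (m k))"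
    if "?D k \<noteq> {}" for k
    using that m[OF that] by (auto simp: discrete_h_def finite_delta_partitions intro!: Min_eqI)
  show ?thesis
  proof (cases "\<forall>\<^sub>F k in U. ?D k = {}")
    case True
    have "hdelta_partitions U N \<delta> B = {}"
    proof (rule ccontr)
      assume "hdelta_partitions U N \<delta> B \<noteq> {}"
      then obtain p where "hclass U p \<in> hdelta_partitions U N \<delta> B"
        unfolding hdelta_partitions_def hext_def by (auto elim: hyperE)
      then have "\<forall>\<^sub>F k in U. p k \<in> ?D k" by (simp add: D)
      with True have "\<forall>\<^sub>F k in U. False" by eventually_elim auto
      then show False
        using U by (simp add: nonprincipal_ultrafilter_def trivial_limit_def)
    qed
    moreover have "hdiscrete_h U s N \<delta> B = hstd U \<infinity>"
      unfolding H hstd_def hclass_eq_iff using True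
      by eventually_elim (simp add: discrete_h_def)
    ultimately show ?thesis by simp
  next
    case False
    then have ne: "\<forall>\<^sub>F k in U. ?D k \<noteq> {}"
      using U by (auto simp: nonprincipal_ultrafilter_def)
    then have mem: "hclass U m \<in> hdelta_partitions U N \<delta> B"
      unfolding D by eventually_elim (rule m)
    have "hdiscrete_h U s N \<delta> B = hereal U (hpartition_sum U s N (hclass U m))"
      unfolding H S hereal_def hstd_def happ_hclass hclass_eq_iff
      using ne by eventually_elim (rule hm)
    moreover have "hle U (hpartition_sum U s N (hclass U m)) (hpartition_sum U s N Q)"
      if Q: "Q \<in> hdelta_partitions U N \<delta> B" for Q
    proof -
      obtain q where q: "Q = hclass U q"
        using Q unfolding hdelta_partitions_def hext_def by (auto elim: hyperE)
      have "\<forall>\<^sub>F k in U. q k \<in> ?D k" using Q by (simp add: q D)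
      then show ?thesis
        unfolding q S hrel_hclass by eventually_elim (use m in blast)
    qed
    ultimately show ?thesis using mem by auto
  qed
qed


section \<open>The hyperfinite grid and the nonstandard expression\<close>

definition infinite_hypernat :: "nat filter \<Rightarrow> nat hyp \<Rightarrow> bool" where
  "infinite_hypernat U N \<longleftrightarrow> N \<in> hyper U \<and> N \<notin> range (hstd U)"

definition Omega :: "nat filter \<Rightarrow> nat hyp \<Rightarrow> real set hyp" where
  "Omega U N = happ U (hstd U grid) N"

lemma hext_Omega:
  assumes "N \<in> hyper U"
  shows "hext U (Omega U N) =
    {happ U (happ U (hstd U (\<lambda>i n. real i / real n)) i) N | i. i \<in> hyper U \<and> hle U i N}"
proof -
  obtain n where n: "N = hclass U n" using assms by (rule hyperE)
  have grid: "Omega U N = hclass U (\<lambda>k. grid (n k))"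
    by (simp add: Omega_def n hstd_def happ_hclass)
  show ?thesis
  proof (intro set_eqI iffI)
    fix X assume X: "X \<in> hext U (Omega U N)"
    then obtain x where x: "X = hclass U x" by (auto simp: hext_def elim: hyperE)
    have ev: "\<forall>\<^sub>F k in U. x k \<in> grid (n k)" using X by (simp add: x grid hclass_in_hext)
    define i where "i k = (SOME i. i \<le> n k \<and> x k = real i / real (n k))" for k
    have i: "i k \<le> n k \<and> x k = real (i k) / real (n k)" if "x k \<in> grid (n k)" for k
      unfolding i_def by (rule someI_ex) (use that in \<open>auto simp: grid_def grid_interval_def\<close>)
    have "hle U (hclass U i) N"
      unfolding n hrel_hclass using ev by eventually_elim (use i in blast)
    moreover have "X = happ U (happ U (hstd U (\<lambda>i n. real i / real n)) (hclass U i)) N"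
      unfolding x n hstd_def happ_hclass hclass_eq_iff using ev
      by eventually_elim (use i in blast)
    ultimately show "X \<in> {happ U (happ U (hstd U (\<lambda>i n. real i / real n)) i) N | i.
        i \<in> hyper U \<and> hle U i N}" by auto
  next
    fix X assume "X \<in> {happ U (happ U (hstd U (\<lambda>i n. real i / real n)) i) N | i.
        i \<in> hyper U \<and> hle U i N}"
    then obtain i where i: "X = happ U (happ U (hstd U (\<lambda>i n. real i / real n)) (hclass U i)) N"
      "hle U (hclass U i) N" by (auto elim: hyperE)
    have "\<forall>\<^sub>F k in U. i k \<le> n k" using i(2) by (simp add: n hrel_hclass)
    then show "X \<in> hext U (Omega U N)"
      unfolding i(1) n grid[unfolded n] hstd_def happ_hclass hclass_in_hext
      by eventually_elim (auto simp: grid_def grid_interval_def)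
  qed
qed

definition st_preimage :: "nat filter \<Rightarrow> nat hyp \<Rightarrow> real set \<Rightarrow> real hyp set" where
  "st_preimage U N A = {x \<in> hext U (Omega U N). st U (hereal U x) \<in> ereal ` A}"

definition inf_st_h :: "nat filter \<Rightarrow> real \<Rightarrow> nat hyp \<Rightarrow> real hyp \<Rightarrow> real set \<Rightarrow> ereal" where
  "inf_st_h U s N \<delta> A =
     Inf {st U (hdiscrete_h U s N \<delta> B) | B.
            B \<in> hyper U \<and> hext U B \<subseteq> hext U (Omega U N) \<and> st_preimage U N A \<subseteq> hext U B}"

end

theory Submission
  imports Defs
begin

text \<open>Write \<open>N\<close> as the class of a sequence \<open>n k\<close>; that \<open>N\<close> is infinite means that \<open>n k\<close> tends to
  infinity along \<open>U\<close>. The standard part of an extended hyperreal is the limit along \<open>U\<close> of any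
  representing sequence (\<open>st_eq_limit\<close>), and such limits always exist because \<open>ereal\<close> is compact.
  So the theorem becomes a statement about limits, along \<open>U\<close>, of finite grids.

  Lower bound (\<open>hausdorff_delta_le_inf_st_h\<close>): for real \<open>\<delta> > 0\<close>, the size-\<open>\<delta>\<close> Hausdorff premeasure
  of \<open>A\<close> is at most \<open>st h\<close> for every internal \<open>B\<close> that contains the monads of the points of \<open>A\<close>.
  Take internal partitions \<open>P k\<close> of \<open>B k\<close> with total cost below \<open>r\<close>. There are hyperfinitely many
  pieces, most of them possibly infinitesimal, so their standard parts are no countable cover. Two
  observations repair this. Since \<open>s \<le> 1\<close>, the map \<open>x \<mapsto> x powr s\<close> is subadditive, so merging two
  adjacent pieces does not increase the cost, and the partitions may be assumed irreducible: two
  adjacent pieces have total diameter above \<open>\<delta>\<close> (\<open>irreducible_partition_exists\<close>). And \<open>B\<close>, being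
  internal, contains with the monad of \<open>a\<close> all grid points in a real neighbourhood of \<open>a\<close>
  (\<open>neighbourhood_in_internal_superset\<close>). Hence near \<open>a\<close> there is no gap between pieces, and if the
  piece through \<open>a\<close> is infinitesimal then its right neighbour has noninfinitesimal diameter and
  still has \<open>a\<close> in its standard part (\<open>nondegenerate_shadow_at_interior_point\<close>). The
  noninfinitesimal pieces are countably many, for each contains a rational in the interior of its
  standard part, and any finitely many of them cost at most \<open>r\<close>
  (\<open>countable_cover_by_shadows\<close>). Only a right endpoint \<open>1\<close> can be missed, and the cover \<open>{1}\<close> of
  it costs nothing.

  Upper bound (\<open>inf_st_h_le_hausdorff_delta\<close>): a countable cover of \<open>A\<close> by sets of diameter at most
  \<open>\<delta>' < \<delta>\<close> is enlarged to open intervals at small extra cost. The union of the traces on the grid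
  of the first \<open>K\<close> intervals, \<open>K\<close> infinite, is an internal set containing all monads of points
  of \<open>A\<close>. The rounding error is \<open>1 / N\<close> in each diameter, at most \<open>K * (1 / N) powr s\<close> altogether, and
  this is infinitesimal if \<open>K\<close> grows slowly. Overlapping grid intervals can be cut down to disjoint
  ones without changing the union (\<open>disjoint_intervals_same_union\<close>).

  Consequently the nonstandard expression at real \<open>\<delta>\<close> lies between the Hausdorff premeasure of size
  \<open>\<delta>\<close> and the Hausdorff measure, so it tends to the latter, whatever \<open>N\<close> is. For infinitesimal \<open>\<delta>\<close>,
  a partition into pieces of infinitesimal size has pieces of size at most \<open>\<epsilon>\<close> for each real
  \<open>\<epsilon> > 0\<close>, so the lower bound applies at every such \<open>\<epsilon>\<close>.\<close>

section \<open>Limits along an ultrafilter and standard parts\<close>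

lemma ultrafilter_ne_bot: "nonprincipal_ultrafilter U \<Longrightarrow> U \<noteq> bot"
  by (simp add: nonprincipal_ultrafilter_def)

lemma ultrafilter_not_eventually:
  assumes "nonprincipal_ultrafilter U"
  shows "\<not> eventually P U \<longleftrightarrow> (\<forall>\<^sub>F n in U. \<not> P n)"
  using assms unfolding nonprincipal_ultrafilter_def trivial_limit_def
  by (smt (verit) eventually_elim2)

text \<open>A cluster point of the image of an ultrafilter is already a limit, as each neighbourhood of it
  or its complement has the image filter eventually inside.\<close>

lemma ultrafilter_limit:
  fixes x :: "nat \<Rightarrow> 'a::topological_space"
  assumes U: "nonprincipal_ultrafilter U" and S: "compact S" and x: "\<forall>\<^sub>F n in U. x n \<in> S"
  obtains L where "L \<in> S" "(x \<longlongrightarrow> L) U"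
proof -
  have "filtermap x U \<noteq> bot" using U by (simp add: filtermap_bot_iff ultrafilter_ne_bot)
  then obtain L where L: "L \<in> S" "inf (nhds L) (filtermap x U) \<noteq> bot"
    using S x unfolding compact_filter by (auto simp: eventually_filtermap)
  have "(x \<longlongrightarrow> L) U"
  proof (rule topological_tendstoI, rule ccontr)
    fix T assume T: "open T" "L \<in> T" and "\<not> (\<forall>\<^sub>F n in U. x n \<in> T)"
    then have "\<forall>\<^sub>F n in U. x n \<notin> T" by (simp add: ultrafilter_not_eventually[OF U])
    then have "\<forall>\<^sub>F y in filtermap x U. y \<notin> T" by (simp add: eventually_filtermap)
    moreover have "\<forall>\<^sub>F y in nhds L. y \<in> T" using T by (simp add: eventually_nhds_in_open)
    ultimately have "inf (nhds L) (filtermap x U) = bot"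
      unfolding trivial_limit_def eventually_inf by blast
    with L show False by simp
  qed
  with L that show thesis by blast
qed

lemma inf_close_iff_tendsto: "inf_close U (hclass U x) r \<longleftrightarrow> (x \<longlongrightarrow> ereal r) U"
proof -
  have close: "\<bar>t - ereal r\<bar> < ereal e \<longleftrightarrow> ereal (r - e) < t \<and> t < ereal (r + e)" for t e
    by (cases t) auto
  have "(\<forall>e>0. \<forall>\<^sub>F n in U. \<bar>x n - ereal r\<bar> < ereal e) \<longleftrightarrow> (x \<longlongrightarrow> ereal r) U"
  proof
    assume *: "\<forall>e>0. \<forall>\<^sub>F n in U. \<bar>x n - ereal r\<bar> < ereal e"
    show "(x \<longlongrightarrow> ereal r) U"
    proof (rule order_tendstoI)
      fix a assume "a < ereal r"
      then obtain q where q: "a < ereal q" "q < r" using ereal_dense2 by (metis ereal_less_eq(3) less_ereal.simps(1))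
      show "\<forall>\<^sub>F n in U. a < x n"
        using *[rule_format, of "r - q"] q
        by (auto simp: close elim!: eventually_mono dest: less_trans)
    next
      fix a assume "ereal r < a"
      then obtain q where q: "ereal q < a" "r < q" using ereal_dense2 by (metis less_ereal.simps(1))
      show "\<forall>\<^sub>F n in U. x n < a"
        using *[rule_format, of "q - r"] q
        by (auto simp: close elim!: eventually_mono dest: less_trans)
    qed
  next
    assume *: "(x \<longlongrightarrow> ereal r) U"
    show "\<forall>e>0. \<forall>\<^sub>F n in U. \<bar>x n - ereal r\<bar> < ereal e"
      unfolding close
      using order_tendstoD[OF *] by (auto intro!: eventually_conj)
  qed
  then show ?thesis
    by (simp add: inf_close_def hstd_def happ_hclass hrel_hclass)
qed

text \<open>This replaces the case distinction in the definition of \<open>st\<close>; the value \<open>-\<infinity>\<close> assigned by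
  default to the remaining elements happens to be their limit as well.\<close>

lemma st_eq_limit:
  assumes U: "nonprincipal_ultrafilter U" and x: "(x \<longlongrightarrow> L) U"
  shows "st U (hclass U x) = L"
proof (cases L)
  case (real r)
  then have "inf_close U (hclass U x) r" using x by (simp add: inf_close_iff_tendsto)
  moreover have "(THE r. inf_close U (hclass U x) r) = r"
    using calculation inf_close_unique[OF U hclass_in_hyper] by (intro the_equality) auto
  ultimately show ?thesis using real by (auto simp: st_def)
next
  case PInf
  have "\<not> inf_close U (hclass U x) r" for r
    using tendsto_unique[OF ultrafilter_ne_bot[OF U] x, of "ereal r"] PInf
    by (auto simp: inf_close_iff_tendsto)
  then show ?thesis using x PInf
    by (simp add: st_def hstd_def hrel_hclass tendsto_PInfty)
next
  case MInf
  have "\<not> inf_close U (hclass U x) r" for r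
    using tendsto_unique[OF ultrafilter_ne_bot[OF U] x, of "ereal r"] MInf
    by (auto simp: inf_close_iff_tendsto)
  moreover have "\<not> (\<forall>\<^sub>F n in U. ereal 0 < x n)"
    using x[unfolded MInf tendsto_MInfty, rule_format, of 0]
    by (auto simp: ultrafilter_not_eventually[OF U] elim!: eventually_mono)
  ultimately show ?thesis using MInf
    by (auto simp: st_def hstd_def hrel_hclass)
qed

lemma st_limit:
  assumes U: "nonprincipal_ultrafilter U"
  shows "(x \<longlongrightarrow> st U (hclass U x)) U"
proof -
  have "compact (UNIV :: ereal set)" by (rule Extended_Real_Limits.compact_UNIV)
  then obtain L where "(x \<longlongrightarrow> L) U" using ultrafilter_limit[OF U] by (metis UNIV_I always_eventually)
  then show ?thesis using st_eq_limit[OF U] by metis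
qed

lemma infinite_hypernat_iff:
  assumes U: "nonprincipal_ultrafilter U"
  shows "infinite_hypernat U (hclass U n) \<longleftrightarrow> filterlim n at_top U"
proof
  assume "infinite_hypernat U (hclass U n)"
  then have "\<not> (\<forall>\<^sub>F k in U. n k = c)" for c
    unfolding infinite_hypernat_def hstd_def by (auto simp: hclass_eq_iff)
  then have ne: "\<forall>\<^sub>F k in U. n k \<noteq> c" for c
    using ultrafilter_not_eventually[OF U] by blast
  have "\<forall>\<^sub>F k in U. c \<le> n k" for c
  proof -
    have "\<forall>\<^sub>F k in U. \<forall>i\<in>{..<c}. n k \<noteq> i"
      using ne by (intro eventually_ball_finite) auto
    then show ?thesis by eventually_elim (metis lessThan_iff not_le)
  qed
  then show "filterlim n at_top U" by (simp add: filterlim_at_top)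
next
  assume n: "filterlim n at_top U"
  have "\<not> (\<forall>\<^sub>F k in U. n k = c)" for c
  proof
    assume "\<forall>\<^sub>F k in U. n k = c"
    moreover have "\<forall>\<^sub>F k in U. Suc c \<le> n k" using n by (simp add: filterlim_at_top)
    ultimately have "\<forall>\<^sub>F k in U. False" by eventually_elim auto
    then show False using U by (simp add: nonprincipal_ultrafilter_def trivial_limit_def)
  qed
  then show "infinite_hypernat U (hclass U n)"
    by (auto simp: infinite_hypernat_def hstd_def hclass_eq_iff)
qed

lemma hclass_in_st_preimage:
  assumes U: "nonprincipal_ultrafilter U"
  shows "hclass U x \<in> st_preimage U (hclass U n) A \<longleftrightarrow>
    (\<forall>\<^sub>F k in U. x k \<in> grid (n k)) \<and> (\<exists>a\<in>A. (x \<longlongrightarrow> a) U)"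
proof -
  have "st U (hereal U (hclass U x)) \<in> ereal ` A \<longleftrightarrow> (\<exists>a\<in>A. (x \<longlongrightarrow> a) U)"
  proof -
    have "hereal U (hclass U x) = hclass U (\<lambda>k. ereal (x k))"
      by (simp add: hereal_def hstd_def happ_hclass)
    moreover have "st U (hclass U (\<lambda>k. ereal (x k))) = ereal a \<longleftrightarrow> (x \<longlongrightarrow> a) U" for a
      using st_limit[OF U, of "\<lambda>k. ereal (x k)"] st_eq_limit[OF U, of "\<lambda>k. ereal (x k)" "ereal a"]
      by (metis tendsto_ereal lim_ereal)
    ultimately show ?thesis by force
  qed
  then show ?thesis
    by (simp add: st_preimage_def Omega_def hstd_def happ_hclass hclass_in_hext)
qed

lemma finite_grid: "finite (grid n)"
  by (simp add: grid_def grid_interval_def)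

text \<open>A form of underspill. If there were grid points outside \<open>B\<close> within every real distance of \<open>a\<close>,
  then the one nearest to \<open>a\<close> would be infinitely close to \<open>a\<close>, hence in \<open>B\<close>.\<close>

lemma neighbourhood_in_internal_superset:
  assumes U: "nonprincipal_ultrafilter U"
    and sub: "st_preimage U (hclass U n) A \<subseteq> hext U (hclass U B)" and a: "a \<in> A"
  obtains \<eta> where "\<eta> > 0" "\<forall>\<^sub>F k in U. \<forall>y\<in>grid (n k). \<bar>y - a\<bar> < \<eta> \<longrightarrow> y \<in> B k"
proof (rule ccontr)
  assume contra: "\<not> thesis"
  define E where "E k = grid (n k) - B k" for k
  define y where "y k = arg_min_on (\<lambda>y. \<bar>y - a\<bar>) (E k)" for k
  have fin: "finite (E k)" for k by (simp add: E_def finite_grid)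
  have E: "\<forall>\<^sub>F k in U. \<exists>z\<in>E k. \<bar>z - a\<bar> < \<eta>" if "\<eta> > 0" for \<eta>
  proof -
    have "\<not> (\<forall>\<^sub>F k in U. \<forall>y\<in>grid (n k). \<bar>y - a\<bar> < \<eta> \<longrightarrow> y \<in> B k)"
      using contra \<open>\<eta> > 0\<close> \<open>\<And>\<eta>. \<lbrakk>0 < \<eta>; _\<rbrakk> \<Longrightarrow> thesis\<close> by blast
    then show ?thesis unfolding ultrafilter_not_eventually[OF U]
      by eventually_elim (auto simp: E_def)
  qed
  have near: "\<forall>\<^sub>F k in U. y k \<in> E k \<and> \<bar>y k - a\<bar> < \<eta>" if "\<eta> > 0" for \<eta>
    using E[OF that]
  proof eventually_elim
    case (elim k)
    then obtain z where z: "z \<in> E k" "\<bar>z - a\<bar> < \<eta>" by blast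
    then have "y k \<in> E k" unfolding y_def using fin by (intro arg_min_if_finite(1)) auto
    moreover have "\<bar>y k - a\<bar> \<le> \<bar>z - a\<bar>"
      unfolding y_def using fin z by (intro arg_min_least) auto
    ultimately show ?case using z by simp
  qed
  have "(y \<longlongrightarrow> a) U"
  proof (rule tendstoI)
    fix e :: real assume "e > 0"
    from near[OF this] show "\<forall>\<^sub>F k in U. dist (y k) a < e"
      by eventually_elim (simp add: dist_real_def)
  qed
  moreover have yE: "\<forall>\<^sub>F k in U. y k \<in> E k" using near[of 1] by (auto elim: eventually_mono)
  ultimately have "hclass U y \<in> st_preimage U (hclass U n) A"
    unfolding hclass_in_st_preimage[OF U] using a by (auto simp: E_def elim!: eventually_mono)
  with sub have "\<forall>\<^sub>F k in U. y k \<in> B k" by (auto simp: hclass_in_hext)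
  with yE have "\<forall>\<^sub>F k in U. False" by eventually_elim (simp add: E_def)
  then show False using U by (simp add: nonprincipal_ultrafilter_def trivial_limit_def)
qed

section \<open>Partitions of grid sets into intervals\<close>

text \<open>With \<open>t = x / (x + y)\<close> in \<open>[0, 1]\<close> one has \<open>t \<le> t powr s\<close>, and likewise for \<open>1 - t\<close>; adding the two
  bounds gives the claim.\<close>

lemma powr_subadditive:
  fixes x y s :: real
  assumes "0 \<le> x" "0 \<le> y" "0 < s" "s \<le> 1"
  shows "(x + y) powr s \<le> x powr s + y powr s"
proof (cases "x + y = 0")
  case False
  then have pos: "x + y > 0" using assms by simp
  have frac: "t / (x + y) \<le> t powr s / (x + y) powr s" if "0 \<le> t" "t \<le> x + y" for t
  proof -
    have "(t / (x + y)) powr 1 \<le> (t / (x + y)) powr s"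
      using that pos assms by (intro powr_mono') auto
    then show ?thesis using that pos by (simp add: powr_divide)
  qed
  have "1 = x / (x + y) + y / (x + y)" using pos by (simp add: add_divide_distrib[symmetric])
  also have "\<dots> \<le> (x powr s + y powr s) / (x + y) powr s"
    using frac[of x] frac[of y] assms by (simp add: add_divide_distrib)
  finally show ?thesis using pos by (simp add: pos_le_divide_eq)
qed (use assms in simp)

lemma grid_point_in_grid_interval_iff:
  assumes "n > 0"
  shows "real c / real n \<in> grid_interval n i j \<longleftrightarrow> i \<le> c \<and> c \<le> j"
  using assms by (auto simp: grid_interval_def)

lemma grid_interval_Min:
  assumes "i \<le> j" shows "Min (grid_interval n i j) = real i / real n"
  using assms by (intro Min_eqI) (auto simp: grid_interval_def divide_right_mono)

lemma grid_interval_Max: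
  assumes "i \<le> j" shows "Max (grid_interval n i j) = real j / real n"
  using assms by (intro Max_eqI) (auto simp: grid_interval_def divide_right_mono)

lemma ddiam_eq_Max_minus_Min:
  assumes "n > 0" "delta_interval n \<delta> V"
  shows "ddiam n V = Max V - Min V + 1 / real n"
proof -
  obtain i j where "i \<le> j" "V = grid_interval n i j" using assms by (auto simp: delta_interval_def)
  then show ?thesis using assms(1)
    by (simp add: ddiam_grid_interval grid_interval_Min grid_interval_Max add_divide_distrib diff_divide_distrib)
qed

lemma delta_interval_Min_Max:
  assumes "n > 0" "delta_interval n \<delta> V"
  shows "Min V \<in> V" "Max V \<in> V" "Min V \<le> Max V" "Min V \<in> grid n" "Max V \<in> grid n"
    "y \<in> V \<longleftrightarrow> y \<in> grid n \<and> Min V \<le> y \<and> y \<le> Max V"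
proof -
  obtain i j where ij: "i \<le> j" "j \<le> n" "V = grid_interval n i j"
    using assms by (auto simp: delta_interval_def)
  show "Min V \<in> V" "Max V \<in> V"
    using ij assms(1) by (simp_all add: grid_interval_Min grid_interval_Max grid_point_in_grid_interval_iff)
  show "Min V \<le> Max V" using ij by (simp add: grid_interval_Min grid_interval_Max divide_right_mono)
  show "Min V \<in> grid n" "Max V \<in> grid n"
    unfolding ij(3) grid_interval_Min[OF ij(1)] grid_interval_Max[OF ij(1)] grid_def
    using ij(1,2) assms(1) by (simp_all add: grid_point_in_grid_interval_iff)
  show "y \<in> V \<longleftrightarrow> y \<in> grid n \<and> Min V \<le> y \<and> y \<le> Max V"
    unfolding ij(3) grid_interval_Min[OF ij(1)] grid_interval_Max[OF ij(1)]
    using ij(2) assms(1)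
    by (auto simp: grid_def grid_interval_def divide_right_mono divide_le_cancel)
qed

text \<open>\<open>W\<close> is the right neighbour of \<open>V\<close> when its first point is one grid step after the last point
  of \<open>V\<close>.\<close>

definition irreducible_partition :: "nat \<Rightarrow> real \<Rightarrow> real set set \<Rightarrow> bool" where
  "irreducible_partition n \<delta> Q \<longleftrightarrow>
     (\<forall>V\<in>Q. \<forall>W\<in>Q. Min W = Max V + 1 / real n \<longrightarrow> \<delta> < ddiam n V + ddiam n W)"

lemma finite_delta_partition:
  assumes "P \<in> delta_partitions n \<delta> B"
  shows "finite P"
proof (rule finite_subset)
  show "P \<subseteq> Pow (grid n)"
    using assms by (fastforce simp: delta_partitions_def delta_interval_def grid_def grid_interval_def)
qed (simp add: grid_def grid_interval_def)

text \<open>The diameter of a union of adjacent cells is the sum of their diameters because the discrete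
  diameter counts points; so subadditivity of \<open>x powr s\<close> bounds the cost of the union.\<close>

lemma merge_adjacent_cells:
  assumes P: "P \<in> delta_partitions n \<delta> B" and n: "n > 0" and s: "0 < s" "s \<le> 1"
    and V: "V \<in> P" and W: "W \<in> P" and adj: "Min W = Max V + 1 / real n"
    and small: "ddiam n V + ddiam n W \<le> \<delta>"
  obtains Q where "Q \<in> delta_partitions n \<delta> B" "partition_sum s n Q \<le> partition_sum s n P"
    "card Q < card P"
proof -
  have part: "partition_on B P" and di: "\<And>X. X \<in> P \<Longrightarrow> delta_interval n \<delta> X"
    using P by (auto simp: delta_partitions_def)
  obtain i j where ij: "i \<le> j" "j \<le> n" "V = grid_interval n i j"
    using di[OF V] by (auto simp: delta_interval_def)
  obtain k l where kl: "k \<le> l" "l \<le> n" "W = grid_interval n k l"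
    using di[OF W] by (auto simp: delta_interval_def)
  have "real k / real n = (real j + 1) / real n"
    using adj ij kl by (simp add: grid_interval_Min grid_interval_Max add_divide_distrib)
  then have k: "k = Suc j" using n by (simp add: divide_cancel_right)
  have VW: "V \<union> W = grid_interval n i l"
  proof -
    have "{i..j} \<union> {Suc j..l} = {i..l}" using ij kl k by auto
    then show ?thesis unfolding ij kl k grid_interval_def image_Un[symmetric] by simp
  qed
  have disj: "disjoint P" using part by (simp add: partition_on_def)
  have ne: "V \<noteq> {}" "W \<noteq> {}" using ij kl by (auto simp: grid_interval_def)
  have "V \<noteq> W"
  proof
    assume "V = W"
    then have "Max V + 1 / real n \<le> Max V"
      using delta_interval_Min_Max(3)[OF n di[OF V]] adj by simp
    then show False using n by simp
  qed
  have VWd: "V \<inter> W = {}" using disj V W \<open>V \<noteq> W\<close> by (simp add: disjointD)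
  have fin: "finite P" by (rule finite_delta_partition[OF P])
  define R where "R = P - {V, W}"
  have R: "finite R" "R \<subseteq> P" "V \<notin> R" "W \<notin> R" "P = insert V (insert W R)"
    using fin V W by (auto simp: R_def)
  have sep: "X \<inter> (V \<union> W) = {}" if "X \<in> R" for X
  proof -
    have "X \<in> P" "X \<noteq> V" "X \<noteq> W" using that by (auto simp: R_def)
    then have "X \<inter> V = {}" "X \<inter> W = {}" using disj V W by (auto dest: disjointD)
    then show ?thesis by blast
  qed
  have VWR: "V \<union> W \<notin> R" using sep[of "V \<union> W"] ne by auto
  have dVW: "ddiam n (V \<union> W) = ddiam n V + ddiam n W"
  proof -
    have "finite V" "finite W" unfolding ij kl by (simp_all add: grid_interval_def)
    then have "card (V \<union> W) = card V + card W" using VWd by (rule card_Un_disjoint)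
    then show ?thesis by (simp add: ddiam_def add_divide_distrib)
  qed
  define Q where "Q = insert (V \<union> W) R"
  have "partition_on B Q"
    unfolding partition_on_def
  proof (intro conjI)
    show "\<Union> Q = B" using part R(5) unfolding Q_def partition_on_def by auto
    have "disjoint R" using disj R(2) by (rule pairwise_subset)
    then show "disjoint Q" unfolding Q_def pairwise_insert using sep
      by (simp add: disjnt_def Int_commute)
    show "{} \<notin> Q" using part R ne by (auto simp: Q_def partition_on_def)
  qed
  moreover have "delta_interval n \<delta> (V \<union> W)"
  proof -
    have "i \<le> l" using ij(1) kl(1) k by linarith
    then have "\<exists>i l. i \<le> l \<and> l \<le> n \<and> V \<union> W = grid_interval n i l" using VW kl(2) by blast
    then show ?thesis unfolding delta_interval_def using dVW small by simp
  qed
  ultimately have "Q \<in> delta_partitions n \<delta> B"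
    using di R(2) by (auto simp: Q_def delta_partitions_def)
  moreover have "partition_sum s n Q \<le> partition_sum s n P"
  proof -
    have "ddiam n (V \<union> W) powr s \<le> ddiam n V powr s + ddiam n W powr s"
      unfolding dVW by (rule powr_subadditive) (use s in \<open>auto simp: ddiam_def\<close>)
    then show ?thesis
      using R(1,3,4) VWR \<open>V \<noteq> W\<close> unfolding partition_sum_def Q_def R(5) by simp
  qed
  moreover have "card Q < card P"
    using R(1,3,4) VWR \<open>V \<noteq> W\<close> unfolding Q_def by (subst R(5)) simp
  ultimately show thesis by (rule that)
qed

text \<open>Merging terminates, since each merge removes a cell.\<close>

lemma irreducible_partition_exists:
  assumes P: "P \<in> delta_partitions n \<delta> B" and n: "n > 0" and s: "0 < s" "s \<le> 1"
  obtains Q where "Q \<in> delta_partitions n \<delta> B" "partition_sum s n Q \<le> partition_sum s n P"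
    "irreducible_partition n \<delta> Q"
  using P
proof (induction "card P" arbitrary: P thesis rule: less_induct)
  case less
  show ?case
  proof (cases "irreducible_partition n \<delta> P")
    case True
    with less.prems show ?thesis by blast
  next
    case False
    then obtain V W where VW: "V \<in> P" "W \<in> P" "Min W = Max V + 1 / real n"
      "ddiam n V + ddiam n W \<le> \<delta>"
      by (auto simp: irreducible_partition_def not_less)
    obtain P' where P': "P' \<in> delta_partitions n \<delta> B"
      "partition_sum s n P' \<le> partition_sum s n P" "card P' < card P"
      using merge_adjacent_cells[OF less.prems(2) n s VW] .
    obtain Q where "Q \<in> delta_partitions n \<delta> B" "partition_sum s n Q \<le> partition_sum s n P'"
      "irreducible_partition n \<delta> Q" by (rule less.hyps[OF P'(3) _ P'(1)])
    then show ?thesis using less.prems(1) P'(2) order_trans by blast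
  qed
qed

text \<open>Keep an interval whose left endpoint is least and trim the others on their left so that they
  start after its right endpoint; they remain intervals, as nothing can stick out on the left of the
  first one. Then treat the others in the same way. Right endpoints never change, and an
  interval may become empty.\<close>

lemma disjoint_intervals_same_union:
  fixes a b :: "'i \<Rightarrow> nat"
  assumes "finite I"
  shows "\<exists>c. (\<forall>i\<in>I. a i \<le> c i) \<and> disjoint_family_on (\<lambda>i. {c i..b i}) I \<and>
     (\<Union>i\<in>I. {c i..b i}) = (\<Union>i\<in>I. {a i..b i})"
  using assms
proof (induction "card I" arbitrary: I a)
  case 0
  then show ?case by (auto simp: disjoint_family_on_def)
next
  case (Suc m)
  then have "I \<noteq> {}" by auto
  define j where "j = arg_min_on a I"
  have j: "j \<in> I" "\<And>i. i \<in> I \<Longrightarrow> a j \<le> a i"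
    unfolding j_def
    by (rule arg_min_if_finite(1)[OF Suc.prems \<open>I \<noteq> {}\<close>])
      (rule arg_min_least[OF Suc.prems \<open>I \<noteq> {}\<close>])
  define a' where "a' i = max (a i) (Suc (b j))" for i
  have "m = card (I - {j})" using Suc.hyps(2) j(1) Suc.prems by simp
  moreover have "finite (I - {j})" using Suc.prems by simp
  ultimately obtain c where c: "\<forall>i\<in>I - {j}. a' i \<le> c i" "disjoint_family_on (\<lambda>i. {c i..b i}) (I - {j})"
     "(\<Union>i\<in>I - {j}. {c i..b i}) = (\<Union>i\<in>I - {j}. {a' i..b i})"
    using Suc.hyps(1)[of "I - {j}" a'] by blast
  have past: "Suc (b j) \<le> c i" "a i \<le> c i" if "i \<in> I" "i \<noteq> j" for i
    using c(1) that unfolding a'_def by auto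
  define c' where "c' = c(j := a j)"
  have "\<forall>i\<in>I. a i \<le> c' i" using past(2) by (simp add: c'_def)
  moreover have "disjoint_family_on (\<lambda>i. {c' i..b i}) I"
  proof -
    have "{c' i..b i} \<inter> {c' k..b k} = {}" if ik: "i \<in> I" "k \<in> I" "i \<noteq> k" for i k
    proof -
      consider "i = j" "k \<noteq> j" | "k = j" "i \<noteq> j" | "i \<noteq> j" "k \<noteq> j"
        using \<open>i \<noteq> k\<close> by blast
      then show ?thesis
      proof cases
        case 1 then show ?thesis using past(1)[of k] ik by (auto simp: c'_def)
      next
        case 2 then show ?thesis using past(1)[of i] ik by (auto simp: c'_def)
      next
        case 3
        then have "{c i..b i} \<inter> {c k..b k} = {}"
          using c(2) ik unfolding disjoint_family_on_def by blast
        then show ?thesis using 3 by (simp add: c'_def)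
      qed
    qed
    then show ?thesis by (simp add: disjoint_family_on_def)
  qed
  moreover have "(\<Union>i\<in>I. {c' i..b i}) = (\<Union>i\<in>I. {a i..b i})"
  proof -
    have eq: "(\<Union>i\<in>I. f i) = f j \<union> (\<Union>i\<in>I - {j}. f i)" for f :: "'i \<Rightarrow> nat set"
      using j(1) by auto
    have "(\<Union>i\<in>I. {c' i..b i}) = {a j..b j} \<union> (\<Union>i\<in>I - {j}. {c i..b i})"
      unfolding eq[of "\<lambda>i. {c' i..b i}"] by (intro arg_cong2[of _ _ _ _ "(\<union>)"] SUP_cong) (auto simp: c'_def)
    also have "\<dots> = {a j..b j} \<union> (\<Union>i\<in>I - {j}. {a' i..b i})" unfolding c(3) ..
    also have "\<dots> = {a j..b j} \<union> (\<Union>i\<in>I - {j}. {a i..b i})"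
    proof -
      have "x \<in> {a' i..b i} \<longleftrightarrow> x \<in> {a i..b i}" if "i \<in> I" "x \<notin> {a j..b j}" for i x
        using j(2)[of i] that by (auto simp: a'_def)
      then have "x \<in> {a j..b j} \<or> (\<exists>i\<in>I - {j}. x \<in> {a' i..b i}) \<longleftrightarrow>
          x \<in> {a j..b j} \<or> (\<exists>i\<in>I - {j}. x \<in> {a i..b i})" for x
        by (metis DiffD1)
      then show ?thesis by (simp only: set_eq_iff Un_iff UN_iff simp_thms)
    qed
    also have "\<dots> = (\<Union>i\<in>I. {a i..b i})" using eq[of "\<lambda>i. {a i..b i}"] by simp
    finally show ?thesis .
  qed
  ultimately show ?case by blast
qed

text \<open>Discrete covers by possibly overlapping intervals are as good as partitions for bounding the
  discrete measure. The bound \<open>l i\<close> on the discrete diameter is left free so that it can be a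
  real length plus a rounding error.\<close>

lemma discrete_h_le_sum:
  assumes n: "n > 0" and I: "finite I" and b: "\<And>i. i \<in> I \<Longrightarrow> b i \<le> n"
    and len: "\<And>i. i \<in> I \<Longrightarrow> (real (Suc (b i)) - real (a i)) / real n \<le> l i"
    and l: "\<And>i. i \<in> I \<Longrightarrow> 0 \<le> l i \<and> l i \<le> \<delta>" and s: "0 < s"
  shows "discrete_h s n \<delta> (\<Union>i\<in>I. grid_interval n (a i) (b i)) \<le> ereal (\<Sum>i\<in>I. l i powr s)"
proof -
  from disjoint_intervals_same_union[OF I, of a b]
  obtain c where c': "(\<forall>i\<in>I. a i \<le> c i) \<and> disjoint_family_on (\<lambda>i. {c i..b i}) I \<and>
    (\<Union>i\<in>I. {c i..b i}) = (\<Union>i\<in>I. {a i..b i})" by (elim exE)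
  have c: "\<And>i. i \<in> I \<Longrightarrow> a i \<le> c i" "disjoint_family_on (\<lambda>i. {c i..b i}) I"
    "(\<Union>i\<in>I. {c i..b i}) = (\<Union>i\<in>I. {a i..b i})"
    using c' by simp_all
  define J where "J = {i\<in>I. c i \<le> b i}"
  define V where "V i = grid_interval n (c i) (b i)" for i
  have inj: "inj (\<lambda>k. real k / real n)" using n by (auto simp: inj_def)
  have J: "finite J" "J \<subseteq> I" using I by (auto simp: J_def)
  have Bsub: "(\<Union>i\<in>I. grid_interval n (a i) (b i)) = (\<Union>i\<in>I. V i)"
    unfolding V_def grid_interval_def image_UN[symmetric] c(3) ..
  also have "\<dots> = (\<Union>i\<in>J. V i)"
  proof -
    have "V i = {}" if "i \<in> I" "i \<notin> J" for i
      using that by (simp add: J_def V_def grid_interval_def)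
    then show ?thesis using J(2) by blast
  qed
  finally have B: "(\<Union>i\<in>I. grid_interval n (a i) (b i)) = (\<Union>i\<in>J. V i)" .
  have Vdisj: "V i \<inter> V k = {}" if "i \<in> J" "k \<in> J" "i \<noteq> k" for i k
  proof -
    have "{c i..b i} \<inter> {c k..b k} = {}"
      using c(2) that J(2) unfolding disjoint_family_on_def by blast
    then have "(\<lambda>k. real k / real n) ` ({c i..b i} \<inter> {c k..b k}) = {}" by (simp only: image_empty)
    then show ?thesis unfolding V_def grid_interval_def image_Int[OF inj] .
  qed
  have dV: "0 \<le> ddiam n (V i)" "ddiam n (V i) \<le> l i" if "i \<in> J" for i
  proof -
    have "ddiam n (V i) = (real (b i) - real (c i) + 1) / real n"
      unfolding V_def using that by (intro ddiam_grid_interval[OF n]) (simp add: J_def)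
    also have "\<dots> \<le> (real (Suc (b i)) - real (a i)) / real n"
      using c(1)[of i] that J by (intro divide_right_mono) auto
    also have "\<dots> \<le> l i" using len that J by blast
    finally show "ddiam n (V i) \<le> l i" .
    show "0 \<le> ddiam n (V i)" by (simp add: ddiam_def)
  qed
  have "V ` J \<in> delta_partitions n \<delta> (\<Union>i\<in>J. V i)"
    unfolding delta_partitions_def
  proof (intro CollectI conjI ballI)
    show "partition_on (\<Union>i\<in>J. V i) (V ` J)"
      unfolding partition_on_def
    proof (intro conjI)
      show "disjoint (V ` J)" using Vdisj by (auto simp: pairwise_def disjnt_def)
      have "V i \<noteq> {}" if "i \<in> J" for i using that by (simp add: V_def grid_interval_def J_def)
      then show "{} \<notin> V ` J" by blast
    qed simp
    fix X assume "X \<in> V ` J"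
    then obtain i where i: "i \<in> J" "X = V i" by blast
    have "\<exists>p q. p \<le> q \<and> q \<le> n \<and> X = grid_interval n p q"
      using i b[of i] unfolding V_def J_def by blast
    moreover have "ddiam n X \<le> \<delta>" using i dV(2)[of i] l[of i] J by force
    ultimately show "delta_interval n \<delta> X" unfolding delta_interval_def by blast
  qed
  then have "discrete_h s n \<delta> (\<Union>i\<in>J. V i) \<le> ereal (partition_sum s n (V ` J))"
    unfolding discrete_h_def using finite_delta_partitions[of n \<delta> "\<Union>i\<in>J. V i"]
    by (simp add: Min_le_iff) blast
  also have "partition_sum s n (V ` J) \<le> (\<Sum>i\<in>J. ddiam n (V i) powr s)"
    unfolding partition_sum_def using sum_image_le[OF J(1), of "\<lambda>X. ddiam n X powr s" V] by (simp add: o_def)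
  also have "\<dots> \<le> (\<Sum>i\<in>J. l i powr s)"
    using dV s by (intro sum_mono powr_mono2) auto
  also have "\<dots> \<le> (\<Sum>i\<in>I. l i powr s)"
    using I J by (intro sum_mono2) auto
  finally show ?thesis unfolding B by simp
qed

lemma grid_Int_open_interval:
  assumes n: "n > 0" and lu: "l < u"
  obtains a b where "grid n \<inter> {l<..<u} = grid_interval n a b" "b \<le> n"
    "(real (Suc b) - real a) / real n \<le> u - l + 1 / real n"
proof -
  define S where "S = {k. k \<le> n \<and> l < real k / real n \<and> real k / real n < u}"
  have gS: "grid n \<inter> {l<..<u} = (\<lambda>k. real k / real n) ` S"
    by (auto simp: grid_def grid_interval_def S_def)
  have fin: "finite S" by (simp add: S_def)
  show thesis
  proof (cases "S = {}")
    case True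
    then show thesis using that[of 1 0] gS lu by (simp add: grid_interval_def)
  next
    case False
    define a b where "a = Min S" and "b = Max S"
    have ab: "a \<in> S" "b \<in> S" using fin False by (auto simp: a_def b_def)
    have le: "a \<le> k" "k \<le> b" if "k \<in> S" for k using fin that by (auto simp: a_def b_def)
    have "S = {a..b}"
    proof (intro set_eqI iffI)
      fix k assume "k \<in> {a..b}"
      then have k: "a \<le> k" "k \<le> b" by auto
      have "real a / real n \<le> real k / real n" "real k / real n \<le> real b / real n"
        using k by (auto intro: divide_right_mono)
      then show "k \<in> S" using ab k by (auto simp: S_def)
    qed (use le in auto)
    moreover have "real b / real n - real a / real n \<le> u - l" using ab by (auto simp: S_def)
    then have "(real (Suc b) - real a) / real n \<le> u - l + 1 / real n"
      by (simp add: add_divide_distrib diff_divide_distrib)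
    moreover have "b \<le> n" using ab by (simp add: S_def)
    ultimately show thesis using that[of a b] gS by (simp add: grid_interval_def)
  qed
qed

section \<open>Standard parts of the cells of an internal partition\<close>

definition grid_floor :: "nat \<Rightarrow> real \<Rightarrow> real" where
  "grid_floor n p = real (nat \<lfloor>p * real n\<rfloor>) / real n"

lemma grid_floor_in_grid:
  assumes "p \<in> {0..1}"
  shows "grid_floor n p \<in> grid n"
proof -
  have "p * real n \<le> real n" using assms by (simp add: mult_left_le_one_le)
  then have "nat \<lfloor>p * real n\<rfloor> \<le> n" by linarith
  then show ?thesis unfolding grid_floor_def grid_def grid_interval_def by auto
qed

lemma grid_floor_tendsto:
  assumes n: "filterlim n at_top U" and p: "0 \<le> p"
  shows "((\<lambda>k. grid_floor (n k) p) \<longlongrightarrow> p) U"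
proof -
  have inv: "((\<lambda>k. 1 / real (n k)) \<longlongrightarrow> 0) U"
    by (rule filterlim_compose[OF lim_1_over_n n])
  have pos: "\<forall>\<^sub>F k in U. 0 < n k" by (rule eventually_compose_filterlim[OF eventually_gt_at_top n])
  have bounds: "\<forall>\<^sub>F k in U. p - 1 / real (n k) \<le> grid_floor (n k) p \<and> grid_floor (n k) p \<le> p"
    using pos
  proof eventually_elim
    case (elim k)
    have "p * real (n k) - 1 \<le> real (nat \<lfloor>p * real (n k)\<rfloor>)"
      "real (nat \<lfloor>p * real (n k)\<rfloor>) \<le> p * real (n k)"
      using p by (linarith, simp add: of_nat_nat)
    then have "(p * real (n k) - 1) / real (n k) \<le> grid_floor (n k) p"
      "grid_floor (n k) p \<le> p * real (n k) / real (n k)"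
      unfolding grid_floor_def by (intro divide_right_mono; simp)+
    then show ?case using elim by (simp add: diff_divide_distrib)
  qed
  show ?thesis
  proof (rule tendsto_sandwich)
    show "((\<lambda>k. p - 1 / real (n k)) \<longlongrightarrow> p) U"
      using tendsto_diff[OF tendsto_const inv, of p] by simp
  qed (use bounds in \<open>auto elim: eventually_mono\<close>)
qed

lemma grid_next:
  assumes n: "n > 0" and z: "z \<in> grid n"
  shows "z < 1 \<Longrightarrow> z + 1 / real n \<in> grid n"
    and "y \<in> grid n \<Longrightarrow> y < z + 1 / real n \<Longrightarrow> y \<le> z"
proof -
  obtain k where k: "k \<le> n" "z = real k / real n" using z by (auto simp: grid_def grid_interval_def)
  have z1: "z + 1 / real n = real (Suc k) / real n" by (simp add: k add_divide_distrib)
  show "z + 1 / real n \<in> grid n" if "z < 1"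
  proof -
    have "Suc k \<le> n" using that k n by simp
    then show ?thesis unfolding z1 grid_def grid_interval_def by (intro image_eqI[OF refl]) simp
  qed
  show "y \<le> z" if y: "y \<in> grid n" "y < z + 1 / real n"
  proof -
    obtain l where l: "y = real l / real n" using y(1) by (auto simp: grid_def grid_interval_def)
    have "l < Suc k" using y(2) n unfolding z1 l by (simp add: divide_less_cancel)
    then show ?thesis unfolding l k by (simp add: divide_right_mono)
  qed
qed

lemma grid_bounds: "y \<in> grid n \<Longrightarrow> 0 \<le> y \<and> y \<le> 1"
  by (cases "n = 0") (auto simp: grid_def grid_interval_def)

text \<open>Finitely many members that are pairwise distinct in the ultrapower are represented by distinct
  members at almost all indices, where their total weight is at most that of all of \<open>Q k\<close>.\<close>

lemma sum_limits_of_distinct_members_le: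
  fixes w :: "nat \<Rightarrow> 'b \<Rightarrow> real"
  assumes U: "U \<noteq> bot" and F: "finite F"
    and mem: "\<And>i. i \<in> F \<Longrightarrow> \<forall>\<^sub>F k in U. v i k \<in> Q k"
    and dist: "\<And>i j. i \<in> F \<Longrightarrow> j \<in> F \<Longrightarrow> i \<noteq> j \<Longrightarrow> \<forall>\<^sub>F k in U. v i k \<noteq> v j k"
    and Q: "\<forall>\<^sub>F k in U. finite (Q k) \<and> (\<Sum>V\<in>Q k. w k V) \<le> r"
    and w: "\<And>k V. 0 \<le> w k V"
    and lim: "\<And>i. i \<in> F \<Longrightarrow> ((\<lambda>k. w k (v i k)) \<longlongrightarrow> \<omega> i) U"
  shows "(\<Sum>i\<in>F. \<omega> i) \<le> r"
proof -
  have "((\<lambda>k. \<Sum>i\<in>F. w k (v i k)) \<longlongrightarrow> (\<Sum>i\<in>F. \<omega> i)) U"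
    using lim by (rule tendsto_sum)
  moreover have "\<forall>\<^sub>F k in U. (\<Sum>i\<in>F. w k (v i k)) \<le> r"
  proof -
    have "\<forall>\<^sub>F k in U. \<forall>i\<in>F. v i k \<in> Q k" using F mem by (simp add: eventually_ball_finite_distrib)
    moreover have "\<forall>\<^sub>F k in U. \<forall>i\<in>F. \<forall>j\<in>F. i \<noteq> j \<longrightarrow> v i k \<noteq> v j k"
      using F dist by (auto simp: eventually_ball_finite_distrib)
    ultimately show ?thesis using Q
    proof eventually_elim
      case (elim k)
      then have inj: "inj_on (\<lambda>i. v i k) F" by (auto simp: inj_on_def)
      have "(\<Sum>i\<in>F. w k (v i k)) = (\<Sum>V\<in>(\<lambda>i. v i k) ` F. w k V)"
        by (simp add: sum.reindex[OF inj])
      also have "\<dots> \<le> (\<Sum>V\<in>Q k. w k V)" using elim w by (intro sum_mono2) auto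
      finally show ?case using elim by simp
    qed
  qed
  ultimately show ?thesis by (rule tendsto_upperbound[OF _ _ U])
qed

text \<open>The sequence \<open>Q\<close> represents an internal family of pairwise disjoint \<open>\<delta>\<close>-intervals of the
  hyperfinite grid; a member of the family is a sequence \<open>V\<close> with \<open>is_cell V\<close>.\<close>

locale internal_cells =
  fixes U :: "nat filter" and n :: "nat \<Rightarrow> nat" and \<delta> :: real and Q :: "nat \<Rightarrow> real set set"
  assumes U: "nonprincipal_ultrafilter U" and n: "filterlim n at_top U"
    and Q: "\<forall>\<^sub>F k in U. disjoint (Q k) \<and> (\<forall>V\<in>Q k. delta_interval (n k) \<delta> V)"
begin

definition is_cell :: "(nat \<Rightarrow> real set) \<Rightarrow> bool" where
  "is_cell V \<longleftrightarrow> (\<forall>\<^sub>F k in U. V k \<in> Q k)"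

text \<open>The interval \<open>{u..v}\<close> is the standard part of the internal interval represented by \<open>V\<close>. It
  degenerates to a point exactly if the diameter of \<open>V\<close> is infinitesimal.\<close>

definition shadow :: "(nat \<Rightarrow> real set) \<Rightarrow> real \<Rightarrow> real \<Rightarrow> bool" where
  "shadow V u v \<longleftrightarrow> ((\<lambda>k. Min (V k)) \<longlongrightarrow> u) U \<and> ((\<lambda>k. Max (V k)) \<longlongrightarrow> v) U"

lemma U_ne_bot: "U \<noteq> bot" by (rule ultrafilter_ne_bot[OF U])

lemma inverse_n_tendsto: "((\<lambda>k. 1 / real (n k)) \<longlongrightarrow> 0) U"
  by (rule filterlim_compose[OF lim_1_over_n n])

lemma n_pos: "\<forall>\<^sub>F k in U. 0 < n k"
  by (rule eventually_compose_filterlim[OF eventually_gt_at_top n])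

lemma is_cellD:
  assumes "is_cell V"
  shows "\<forall>\<^sub>F k in U. 0 < n k \<and> V k \<in> Q k \<and> delta_interval (n k) \<delta> (V k)"
  using assms[unfolded is_cell_def] Q n_pos by eventually_elim blast

lemma eventually_cell:
  assumes "is_cell V"
    and "\<And>k. 0 < n k \<Longrightarrow> V k \<in> Q k \<Longrightarrow> delta_interval (n k) \<delta> (V k) \<Longrightarrow> P k"
  shows "\<forall>\<^sub>F k in U. P k"
  using is_cellD[OF assms(1)] by eventually_elim (simp add: assms(2))

lemmas cell_Min_Max = delta_interval_Min_Max[where \<delta> = \<delta>]

lemma cell_Min_Max_bounds:
  assumes V: "is_cell V"
  shows "\<forall>\<^sub>F k in U. 0 \<le> Min (V k)" "\<forall>\<^sub>F k in U. Min (V k) \<le> Max (V k)"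
    "\<forall>\<^sub>F k in U. Max (V k) \<le> 1"
proof -
  show "\<forall>\<^sub>F k in U. 0 \<le> Min (V k)"
    by (rule eventually_cell[OF V]) (use cell_Min_Max(4) grid_bounds in blast)
  show "\<forall>\<^sub>F k in U. Min (V k) \<le> Max (V k)"
    by (rule eventually_cell[OF V]) (rule cell_Min_Max(3))
  show "\<forall>\<^sub>F k in U. Max (V k) \<le> 1"
    by (rule eventually_cell[OF V]) (use cell_Min_Max(5) grid_bounds in blast)
qed

lemma shadow_bounds:
  assumes V: "is_cell V" and uv: "shadow V u v"
  shows "0 \<le> u" "u \<le> v" "v \<le> 1" "v - u \<le> \<delta>"
    and "((\<lambda>k. ddiam (n k) (V k)) \<longlongrightarrow> v - u) U"
proof -
  have Min: "((\<lambda>k. Min (V k)) \<longlongrightarrow> u) U" and Max: "((\<lambda>k. Max (V k)) \<longlongrightarrow> v) U"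
    using uv by (simp_all add: shadow_def)
  show "0 \<le> u" "u \<le> v" "v \<le> 1"
    by (rule tendsto_lowerbound[OF Min cell_Min_Max_bounds(1)[OF V] U_ne_bot]
        tendsto_le[OF U_ne_bot Max Min cell_Min_Max_bounds(2)[OF V]]
        tendsto_upperbound[OF Max cell_Min_Max_bounds(3)[OF V] U_ne_bot])+
  have "((\<lambda>k. Max (V k) - Min (V k) + 1 / real (n k)) \<longlongrightarrow> v - u + 0) U"
    by (intro tendsto_add tendsto_diff Min Max inverse_n_tendsto)
  moreover have "\<forall>\<^sub>F k in U. Max (V k) - Min (V k) + 1 / real (n k) = ddiam (n k) (V k)"
    using is_cellD[OF V] by eventually_elim (simp add: ddiam_eq_Max_minus_Min[where \<delta> = \<delta>])
  ultimately show lim: "((\<lambda>k. ddiam (n k) (V k)) \<longlongrightarrow> v - u) U"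
    by (simp add: tendsto_cong)
  have "\<forall>\<^sub>F k in U. ddiam (n k) (V k) \<le> \<delta>"
    using is_cellD[OF V] by eventually_elim (simp add: delta_interval_def)
  then show "v - u \<le> \<delta>" by (rule tendsto_upperbound[OF lim _ U_ne_bot])
qed

lemma shadow_exists:
  assumes V: "is_cell V"
  obtains u v where "shadow V u v"
proof -
  have "\<forall>\<^sub>F k in U. Min (V k) \<in> {0..1}" "\<forall>\<^sub>F k in U. Max (V k) \<in> {0..1}"
    using cell_Min_Max_bounds[OF V] by (eventually_elim, simp)+
  then obtain u v where "((\<lambda>k. Min (V k)) \<longlongrightarrow> u) U" "((\<lambda>k. Max (V k)) \<longlongrightarrow> v) U"
    using ultrafilter_limit[OF U compact_Icc, of "\<lambda>k. Min (V k)" 0 1]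
      ultrafilter_limit[OF U compact_Icc, of "\<lambda>k. Max (V k)" 0 1] by metis
  then show thesis using that by (simp add: shadow_def)
qed

lemma limit_point_in_shadow:
  assumes V: "is_cell V" and uv: "shadow V u v"
    and g: "(g \<longlongrightarrow> x) U" "\<forall>\<^sub>F k in U. g k \<in> V k"
  shows "u \<le> x" "x \<le> v"
proof -
  have *: "\<forall>\<^sub>F k in U. Min (V k) \<le> g k \<and> g k \<le> Max (V k)"
    using is_cellD[OF V] g(2)
  proof eventually_elim
    case (elim k)
    then show ?case using cell_Min_Max(6)[of "n k" "V k" "g k"] by simp
  qed
  have "\<forall>\<^sub>F k in U. Min (V k) \<le> g k" using * by eventually_elim simp
  then show "u \<le> x" using uv g(1) unfolding shadow_def by (blast intro: tendsto_le[OF U_ne_bot])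
  have "\<forall>\<^sub>F k in U. g k \<le> Max (V k)" using * by eventually_elim simp
  then show "x \<le> v" using uv g(1) unfolding shadow_def by (blast intro: tendsto_le[OF U_ne_bot])
qed

text \<open>This is how a noninfinitesimal cell is identified by a real, in particular by a rational,
  point.\<close>

lemma interior_point_in_cell:
  assumes V: "is_cell V" and uv: "shadow V u v" and p: "u < p" "p < v"
  shows "\<forall>\<^sub>F k in U. grid_floor (n k) p \<in> V k"
proof -
  have p01: "p \<in> {0..1}" using p shadow_bounds[OF V uv] by simp
  have lim: "((\<lambda>k. grid_floor (n k) p) \<longlongrightarrow> p) U"
    using p01 by (intro grid_floor_tendsto[OF n]) simp
  have Min: "((\<lambda>k. Min (V k)) \<longlongrightarrow> u) U" and Max: "((\<lambda>k. Max (V k)) \<longlongrightarrow> v) U"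
    using uv by (simp_all add: shadow_def)
  have "\<forall>\<^sub>F k in U. 0 < grid_floor (n k) p - Min (V k)"
    "\<forall>\<^sub>F k in U. 0 < Max (V k) - grid_floor (n k) p"
    using p by (intro order_tendstoD(1)[OF tendsto_diff[OF lim Min]]
        order_tendstoD(1)[OF tendsto_diff[OF Max lim]]; simp)+
  then show ?thesis using is_cellD[OF V]
  proof eventually_elim
    case (elim k)
    then show ?case
      using cell_Min_Max(6)[of "n k" "V k" "grid_floor (n k) p"] grid_floor_in_grid[OF p01, of "n k"]
      by simp
  qed
qed

lemma cell_through:
  assumes g: "\<forall>\<^sub>F k in U. g k \<in> \<Union> (Q k)"
  obtains V where "is_cell V" "\<forall>\<^sub>F k in U. g k \<in> V k"
proof -
  define V where "V k = (SOME V. V \<in> Q k \<and> g k \<in> V)" for k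
  have *: "\<forall>\<^sub>F k in U. V k \<in> Q k \<and> g k \<in> V k"
    using g
  proof eventually_elim
    case (elim k)
    then have "\<exists>V. V \<in> Q k \<and> g k \<in> V" by blast
    then show ?case unfolding V_def by (rule someI_ex)
  qed
  show thesis
  proof (rule that)
    show "is_cell V" unfolding is_cell_def using * by eventually_elim simp
    show "\<forall>\<^sub>F k in U. g k \<in> V k" using * by eventually_elim simp
  qed
qed

text \<open>Let \<open>V\<close> be the cell through a grid point infinitely close to \<open>x\<close>. If \<open>V\<close> is infinitesimal, the
  next grid point after \<open>V\<close> is still infinitely close to \<open>x\<close>, so it belongs to some cell \<open>W\<close>; this
  \<open>W\<close> is adjacent to \<open>V\<close>, and irreducibility forces its diameter to be at least \<open>\<delta>\<close> up to an
  infinitesimal. The argument needs a grid point to the right, hence \<open>x < 1\<close>.\<close>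

lemma nondegenerate_shadow_at_interior_point:
  assumes \<delta>: "0 < \<delta>" and x: "0 \<le> x" "x < 1"
    and irr: "\<forall>\<^sub>F k in U. irreducible_partition (n k) \<delta> (Q k)"
    and \<eta>: "\<eta> > 0" "\<forall>\<^sub>F k in U. \<forall>y\<in>grid (n k). \<bar>y - x\<bar> < \<eta> \<longrightarrow> y \<in> \<Union> (Q k)"
  obtains V u v where "is_cell V" "shadow V u v" "u < v" "u \<le> x" "x \<le> v"
proof -
  have through: "\<forall>\<^sub>F k in U. g k \<in> \<Union> (Q k)"
    if g: "(g \<longlongrightarrow> x) U" "\<forall>\<^sub>F k in U. g k \<in> grid (n k)" for g
    using tendstoD[OF g(1) \<eta>(1)] g(2) \<eta>(2) by eventually_elim (simp add: dist_real_def)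
  have g: "((\<lambda>k. grid_floor (n k) x) \<longlongrightarrow> x) U" by (rule grid_floor_tendsto[OF n x(1)])
  have "\<forall>\<^sub>F k in U. grid_floor (n k) x \<in> grid (n k)"
    using x by (intro always_eventually allI grid_floor_in_grid) auto
  from cell_through[OF through[OF g this]]
  obtain V where V: "is_cell V" "\<forall>\<^sub>F k in U. grid_floor (n k) x \<in> V k" .
  obtain u v where uv: "shadow V u v" using shadow_exists[OF V(1)] .
  note ux = limit_point_in_shadow[OF V(1) uv g V(2)]
  show thesis
  proof (cases "u < v")
    case True
    then show thesis using that[OF V(1) uv] ux by simp
  next
    case False
    then have [simp]: "u = x" "v = x" using ux by auto
    \<comment> \<open>The first grid point after the infinitesimal cell \<open>V\<close>.\<close>
    define h where "h k = Max (V k) + 1 / real (n k)" for k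
    have Vlim: "((\<lambda>k. Max (V k)) \<longlongrightarrow> x) U" using uv by (simp add: shadow_def)
    have hlim: "(h \<longlongrightarrow> x) U"
      using tendsto_add[OF Vlim inverse_n_tendsto] by (simp add: h_def[abs_def])
    have "\<forall>\<^sub>F k in U. h k \<in> grid (n k)"
      using order_tendstoD(2)[OF Vlim x(2)] is_cellD[OF V(1)]
      unfolding h_def by eventually_elim (simp add: cell_Min_Max(5) grid_next(1))
    from cell_through[OF through[OF hlim this]]
    obtain W where W: "is_cell W" "\<forall>\<^sub>F k in U. h k \<in> W k" .
    obtain u' v' where uv': "shadow W u' v'" using shadow_exists[OF W(1)] .
    have "\<forall>\<^sub>F k in U. \<delta> \<le> ddiam (n k) (V k) + ddiam (n k) (W k)"
      using is_cellD[OF V(1)] is_cellD[OF W(1)] W(2) Q irr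
    proof eventually_elim
      case (elim k)
      then have nk: "0 < n k" and VQ: "V k \<in> Q k" and WQ: "W k \<in> Q k"
        and "delta_interval (n k) \<delta> (V k)" "delta_interval (n k) \<delta> (W k)"
        and hW: "h k \<in> W k" and disj: "disjoint (Q k)"
        and irrk: "irreducible_partition (n k) \<delta> (Q k)" by simp_all
      note Vk = cell_Min_Max[OF nk this(4)] and Wk = cell_Min_Max[OF nk this(5)]
      have gap: "Max (V k) < h k" using nk by (simp add: h_def)
      \<comment> \<open>Otherwise \<open>W k\<close> reaches back across the grid step to the last point of \<open>V k\<close>, against disjointness.\<close>
      have "Min (W k) = h k"
      proof (rule ccontr)
        assume "Min (W k) \<noteq> h k"
        then have "Min (W k) < h k" using Wk(6)[of "h k"] hW by simp
        then have "Min (W k) \<le> Max (V k)"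
          using grid_next(2)[OF nk Vk(5) Wk(4)] by (simp add: h_def)
        moreover have "Max (V k) \<le> Max (W k)" using gap Wk(6)[of "h k"] hW by simp
        ultimately have "Max (V k) \<in> W k" using Wk(6) Vk(5) by simp
        then have "V k \<inter> W k \<noteq> {}" using Vk(2) by blast
        then have "V k = W k" using disj VQ WQ by (meson disjointD)
        then show False using Vk(6)[of "h k"] hW gap by simp
      qed
      then show ?case using irrk VQ WQ unfolding irreducible_partition_def h_def
        by (meson less_imp_le)
    qed
    moreover have "((\<lambda>k. ddiam (n k) (V k) + ddiam (n k) (W k)) \<longlongrightarrow> (v - u) + (v' - u')) U"
      by (intro tendsto_add shadow_bounds(5) V(1) uv W(1) uv')
    ultimately have "\<delta> \<le> (v - u) + (v' - u')" by (intro tendsto_lowerbound[OF _ _ U_ne_bot])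
    then have "u' < v'" using \<delta> by simp
    then show thesis using that[OF W(1) uv'] limit_point_in_shadow[OF W(1) uv' hlim W(2)] by simp
  qed
qed

text \<open>Enumerate the rationals. Each noninfinitesimal cell is the cell through some rational, so the
  cells through rationals, with repetitions removed, form a sequence. Repetition is
  meant in the ultrapower, that is, almost everywhere along \<open>U\<close>. Partial sums involve finitely many
  distinct cells only, so their costs have a sum bounded by that of the whole internal family.\<close>

lemma countable_cover_by_shadows:
  assumes \<delta>: "0 < \<delta>" and s: "0 < s"
    and sum: "\<forall>\<^sub>F k in U. finite (Q k) \<and> partition_sum s (n k) (Q k) \<le> r"
  obtains C :: "nat \<Rightarrow> real set"
  where "\<And>i. bounded (C i) \<and> diameter (C i) \<le> \<delta>"
    and "\<And>W u v. is_cell W \<Longrightarrow> shadow W u v \<Longrightarrow> u < v \<Longrightarrow> \<exists>i. C i = {u..v}"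
    and "\<And>M. (\<Sum>i<M. diameter (C i) powr s) \<le> r"
proof -
  define q where "q = from_nat_into (\<rat> :: real set)"
  \<comment> \<open>Where no cell contains the grid point this is an arbitrary set; \<open>is_cell\<close> decides below whether it may be used.\<close>
  define V where "V i k = (THE V. V \<in> Q k \<and> grid_floor (n k) (q i) \<in> V)" for i k
  define same where "same i j \<longleftrightarrow> (\<forall>\<^sub>F k in U. V i k = V j k)" for i j
  \<comment> \<open>The least index at which a given cell occurs.\<close>
  define first where "first i \<longleftrightarrow> is_cell (V i) \<and> (\<forall>j<i. \<not> same j i)" for i
  have "\<exists>u v. is_cell (V i) \<longrightarrow> shadow (V i) u v" for i
    using shadow_exists[of "V i"] by blast
  then obtain u v where uv: "\<And>i. is_cell (V i) \<Longrightarrow> shadow (V i) (u i) (v i)"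
    by metis
  define C where "C i = (if first i then {u i..v i} else {})" for i
  have firstD: "is_cell (V i)" "shadow (V i) (u i) (v i)" if "first i" for i
    using that uv by (auto simp: first_def)
  show thesis
  proof (rule that)
    show "bounded (C i) \<and> diameter (C i) \<le> \<delta>" for i
      using \<delta> shadow_bounds[OF firstD] by (auto simp: C_def)
  next
    fix W a b assume W: "is_cell W" "shadow W a b" "a < b"
    obtain p where p: "p \<in> \<rat>" "a < p" "p < b" using Rats_dense_in_real[OF W(3)] by blast
    obtain i where i: "q i = p"
      using from_nat_into_surj[OF countable_rat p(1)] by (auto simp: q_def)
    have ViW: "\<forall>\<^sub>F k in U. V i k = W k"
      using interior_point_in_cell[OF W(1,2) p(2,3)] is_cellD[OF W(1)] Q
    proof eventually_elim
      case (elim k)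
      have "X = W k" if "X \<in> Q k" "grid_floor (n k) p \<in> X" for X
      proof -
        have "X \<inter> W k \<noteq> {}" using that(2) elim(1) by blast
        then show ?thesis using elim that(1) by (meson disjointD)
      qed
      then show ?case unfolding V_def i using elim by (intro the_equality) simp_all
    qed
    define j where "j = (LEAST j. same j i)"
    have "same i i" by (simp add: same_def)
    then have ji: "same j i" unfolding j_def by (rule LeastI)
    have least: "\<not> same l i" if "l < j" for l
      using that unfolding j_def by (rule not_less_Least)
    have VjW: "\<forall>\<^sub>F k in U. V j k = W k" using ji ViW unfolding same_def by eventually_elim simp
    have "is_cell (V j)"
      using VjW W(1) unfolding is_cell_def by eventually_elim simp
    moreover have "\<not> same l j" if "l < j" for l
    proof
      assume "same l j"
      then have "same l i" using ji unfolding same_def by eventually_elim simp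
      then show False using least that by blast
    qed
    ultimately have f: "first j" by (simp add: first_def)
    have "((\<lambda>k. Min (V j k)) \<longlongrightarrow> a) U" "((\<lambda>k. Max (V j k)) \<longlongrightarrow> b) U"
    proof -
      have "\<forall>\<^sub>F k in U. Min (W k) = Min (V j k)" "\<forall>\<^sub>F k in U. Max (W k) = Max (V j k)"
        using VjW by (eventually_elim; simp)+
      then show "((\<lambda>k. Min (V j k)) \<longlongrightarrow> a) U" "((\<lambda>k. Max (V j k)) \<longlongrightarrow> b) U"
        using W(2) unfolding shadow_def by (blast intro: Lim_transform_eventually)+
    qed
    then have "u j = a" "v j = b"
      using firstD(2)[OF f] unfolding shadow_def by (blast intro: tendsto_unique[OF U_ne_bot])+
    then show "\<exists>i. C i = {a..b}" using f by (intro exI[of _ j]) (simp add: C_def)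
  next
    fix M
    define F where "F = {i\<in>{..<M}. first i}"
    have FD: "first i" if "i \<in> F" for i using that by (simp add: F_def)
    have "diameter (C i) powr s = (if first i then (v i - u i) powr s else 0)" for i
      using shadow_bounds(2)[OF firstD, of i] by (cases "first i") (simp_all add: C_def)
    then have "(\<Sum>i<M. diameter (C i) powr s) = (\<Sum>i<M. if first i then (v i - u i) powr s else 0)"
      by simp
    also have "\<dots> = (\<Sum>i\<in>F. (v i - u i) powr s)"
      unfolding F_def by (rule sum.inter_filter[symmetric]) simp
    also have "\<dots> \<le> r"
    proof (rule sum_limits_of_distinct_members_le[OF U_ne_bot])
      show "finite F" by (simp add: F_def)
      show "\<forall>\<^sub>F k in U. V i k \<in> Q k" if "i \<in> F" for i
        using firstD(1)[OF FD[OF that]] by (simp add: is_cell_def)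
      show "\<forall>\<^sub>F k in U. V i k \<noteq> V j k" if "i \<in> F" "j \<in> F" "i \<noteq> j" for i j
      proof -
        have "\<not> same i j \<or> \<not> same j i"
          using FD[OF that(1)] FD[OF that(2)] that(3) linorder_neqE_nat unfolding first_def by blast
        then show ?thesis unfolding same_def ultrafilter_not_eventually[OF U]
          by (auto elim: eventually_mono)
      qed
      show "\<forall>\<^sub>F k in U. finite (Q k) \<and> (\<Sum>V\<in>Q k. ddiam (n k) V powr s) \<le> r"
        using sum by (simp add: partition_sum_def)
      show "((\<lambda>k. ddiam (n k) (V i k) powr s) \<longlongrightarrow> (v i - u i) powr s) U" if "i \<in> F" for i
        using shadow_bounds(5)[OF firstD[OF FD[OF that]]] s
        by (intro tendsto_powr') (auto simp: ddiam_def)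
    qed simp
    finally show "(\<Sum>i<M. diameter (C i) powr s) \<le> r" .
  qed
qed

end

section \<open>The lower bound\<close>

text \<open>The assumption on neighbourhoods is what remains of \<open>B\<close> containing the monads of the points of
  \<open>A\<close>.\<close>

lemma hausdorff_delta_le_partition_sum:
  fixes A :: "real set"
  assumes U: "nonprincipal_ultrafilter U" and n: "filterlim n at_top U"
    and A: "A \<subseteq> {0..1}" and s: "0 < s" "s \<le> 1" and \<delta>: "0 < \<delta>"
    and P: "\<forall>\<^sub>F k in U. \<exists>P\<in>delta_partitions (n k) \<delta> (B k). partition_sum s (n k) P \<le> r"
    and nbhd: "\<And>a. a \<in> A \<Longrightarrow>
      \<exists>\<eta>>0. \<forall>\<^sub>F k in U. \<forall>y\<in>grid (n k). \<bar>y - a\<bar> < \<eta> \<longrightarrow> y \<in> B k"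
  shows "hausdorff_delta s \<delta> A \<le> ereal r"
proof -
  have npos: "\<forall>\<^sub>F k in U. 0 < n k"
    by (rule eventually_compose_filterlim[OF eventually_gt_at_top n])
  define Q where "Q k = (SOME Q. Q \<in> delta_partitions (n k) \<delta> (B k) \<and>
      partition_sum s (n k) Q \<le> r \<and> irreducible_partition (n k) \<delta> Q)" for k
  have reduced: "\<forall>\<^sub>F k in U. Q k \<in> delta_partitions (n k) \<delta> (B k) \<and>
      partition_sum s (n k) (Q k) \<le> r \<and> irreducible_partition (n k) \<delta> (Q k)"
    using P npos
  proof eventually_elim
    case (elim k)
    then obtain P where P: "P \<in> delta_partitions (n k) \<delta> (B k)" "partition_sum s (n k) P \<le> r"
      by blast
    obtain Q' where "Q' \<in> delta_partitions (n k) \<delta> (B k)"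
      "partition_sum s (n k) Q' \<le> partition_sum s (n k) P" "irreducible_partition (n k) \<delta> Q'"
      by (rule irreducible_partition_exists[OF P(1) elim(2) s])
    then have "\<exists>Q. Q \<in> delta_partitions (n k) \<delta> (B k) \<and>
      partition_sum s (n k) Q \<le> r \<and> irreducible_partition (n k) \<delta> Q"
      using P(2) by (intro exI[of _ Q']) simp
    then show ?case unfolding Q_def by (rule someI_ex)
  qed
  have UnQ: "\<forall>\<^sub>F k in U. \<Union> (Q k) = B k"
    using reduced by eventually_elim (simp add: delta_partitions_def partition_on_def)
  interpret internal_cells U n \<delta> Q
  proof
    show "\<forall>\<^sub>F k in U. disjoint (Q k) \<and> (\<forall>V\<in>Q k. delta_interval (n k) \<delta> V)"
      using reduced by eventually_elim (simp add: delta_partitions_def partition_on_def)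
  qed (fact U n)+
  have irr: "\<forall>\<^sub>F k in U. irreducible_partition (n k) \<delta> (Q k)"
    using reduced by eventually_elim simp
  have "\<forall>\<^sub>F k in U. finite (Q k) \<and> partition_sum s (n k) (Q k) \<le> r"
    using reduced by eventually_elim (blast intro: finite_delta_partition)
  from countable_cover_by_shadows[OF \<delta> s(1) this]
  obtain C :: "nat \<Rightarrow> real set"
    where C: "\<And>i. bounded (C i) \<and> diameter (C i) \<le> \<delta>"
      and CW: "\<And>W u v. is_cell W \<Longrightarrow> shadow W u v \<Longrightarrow> u < v \<Longrightarrow> \<exists>i. C i = {u..v}"
      and sum: "\<And>M. (\<Sum>i<M. diameter (C i) powr s) \<le> r" by blast
  \<comment> \<open>A one-point set has diameter \<open>0\<close>, and \<open>0 powr s = 0\<close>.\<close>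
  define D where "D i = (case i of 0 \<Rightarrow> {1} | Suc i \<Rightarrow> C i)" for i
  have "A \<subseteq> (\<Union>i. D i)"
  proof
    fix x assume x: "x \<in> A"
    show "x \<in> (\<Union>i. D i)"
    proof (cases "x = 1")
      case True
      then have "x \<in> D 0" by (simp add: D_def)
      then show ?thesis by blast
    next
      case False
      then have x01: "0 \<le> x" "x < 1" using x A by auto
      obtain \<eta> where \<eta>: "\<eta> > 0" "\<forall>\<^sub>F k in U. \<forall>y\<in>grid (n k). \<bar>y - x\<bar> < \<eta> \<longrightarrow> y \<in> B k"
        using nbhd[OF x] by blast
      have "\<forall>\<^sub>F k in U. \<forall>y\<in>grid (n k). \<bar>y - x\<bar> < \<eta> \<longrightarrow> y \<in> \<Union> (Q k)"
        using \<eta>(2) UnQ by eventually_elim simp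
      from nondegenerate_shadow_at_interior_point[OF \<delta> x01 irr \<eta>(1) this]
      obtain W u v where W: "is_cell W" "shadow W u v" "u < v" "u \<le> x" "x \<le> v" .
      obtain i where "C i = {u..v}" using CW[OF W(1-3)] by blast
      then have "x \<in> D (Suc i)" using W by (simp add: D_def)
      then show ?thesis by blast
    qed
  qed
  moreover have "\<forall>i. bounded (D i) \<and> diameter (D i) \<le> \<delta>"
    using C \<delta> by (auto simp: D_def split: nat.split)
  ultimately have "hausdorff_delta s \<delta> A \<le> (\<Sum>i. ereal (diameter (D i) powr s))"
    unfolding hausdorff_delta_def by (intro Inf_lower) blast
  also have "\<dots> \<le> ereal r"
  proof (rule suminf_bound, rule allI)
    fix M
    have "(\<Sum>i<M. diameter (D i) powr s) \<le> (\<Sum>i<Suc M. diameter (D i) powr s)" by simp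
    also have "\<dots> = (\<Sum>i<M. diameter (C i) powr s)"
      unfolding sum.lessThan_Suc_shift by (simp add: D_def)
    finally show "(\<Sum>i<M. ereal (diameter (D i) powr s)) \<le> ereal r" using sum[of M] by simp
  qed simp
  finally show ?thesis .
qed

lemma ereal_le_if_le_reals_above:
  fixes x S :: ereal
  assumes "\<And>r. S < ereal r \<Longrightarrow> x \<le> ereal r"
  shows "x \<le> S"
proof (rule dense_ge)
  fix y assume "S < y"
  then show "x \<le> y" using assms by (cases y) auto
qed

text \<open>The sequence \<open>d\<close> may represent a real \<open>\<delta>\<close> or an infinitesimal; in either case the partitions
  that it allows are partitions into \<open>\<delta>\<close>-intervals.\<close>

lemma hausdorff_delta_le_inf_st_h:
  assumes U: "nonprincipal_ultrafilter U" and n: "filterlim n at_top U"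
    and A: "A \<subseteq> {0..1}" and s: "0 < s" "s \<le> 1" and \<delta>: "0 < \<delta>"
    and d: "\<forall>\<^sub>F k in U. d k \<le> \<delta>"
  shows "hausdorff_delta s \<delta> A \<le> inf_st_h U s (hclass U n) (hclass U d) A"
  unfolding inf_st_h_def
proof (rule Inf_greatest)
  fix S assume "S \<in> {st U (hdiscrete_h U s (hclass U n) (hclass U d) B) | B.
      B \<in> hyper U \<and> hext U B \<subseteq> hext U (Omega U (hclass U n)) \<and>
      st_preimage U (hclass U n) A \<subseteq> hext U B}"
  then obtain B' where B': "S = st U (hdiscrete_h U s (hclass U n) (hclass U d) B')" "B' \<in> hyper U"
    "st_preimage U (hclass U n) A \<subseteq> hext U B'" by blast
  obtain B where B: "B' = hclass U B" using B'(2) by (rule hyperE)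
  define h where "h k = discrete_h s (n k) (d k) (B k)" for k
  have "hdiscrete_h U s (hclass U n) (hclass U d) B' = hclass U h"
    by (simp add: hdiscrete_h_def hstd_def happ_hclass B h_def[abs_def])
  then have lim: "(h \<longlongrightarrow> S) U" using st_limit[OF U] B'(1) by metis
  have "hausdorff_delta s \<delta> A \<le> ereal r" if r: "S < ereal r" for r
  proof (rule hausdorff_delta_le_partition_sum[OF U n A s \<delta>])
    show "\<forall>\<^sub>F k in U. \<exists>P\<in>delta_partitions (n k) \<delta> (B k). partition_sum s (n k) P \<le> r"
      using order_tendstoD(2)[OF lim r] d
    proof eventually_elim
      case (elim k)
      let ?D = "delta_partitions (n k) (d k) (B k)"
      have ne: "?D \<noteq> {}" using elim(1) by (auto simp: h_def discrete_h_def)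
      then have "Min (partition_sum s (n k) ` ?D) < r"
        using elim(1) by (simp add: h_def discrete_h_def)
      then obtain P where P: "P \<in> ?D" "partition_sum s (n k) P < r"
        using ne finite_delta_partitions by (auto simp: Min_less_iff)
      have "P \<in> delta_partitions (n k) \<delta> (B k)"
        using P(1) elim(2) by (auto simp: delta_partitions_def delta_interval_def)
      then show ?case using P(2) less_imp_le by blast
    qed
    show "\<exists>\<eta>>0. \<forall>\<^sub>F k in U. \<forall>y\<in>grid (n k). \<bar>y - a\<bar> < \<eta> \<longrightarrow> y \<in> B k" if "a \<in> A" for a
      using neighbourhood_in_internal_superset[OF U B'(3)[unfolded B] that] by blast
  qed
  then show "hausdorff_delta s \<delta> A \<le> S" by (rule ereal_le_if_le_reals_above)
qed

section \<open>The upper bound\<close>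

lemma bounded_real_set_in_interval:
  fixes S :: "real set"
  assumes "bounded S"
  obtains l where "S \<subseteq> {l..l + diameter S}"
proof (cases "S = {}")
  case False
  have "S \<subseteq> {Sup S - diameter S..Sup S}"
  proof
    fix x assume x: "x \<in> S"
    have "Sup S \<le> x + diameter S"
    proof (rule cSup_least[OF False])
      fix y assume "y \<in> S"
      then have "\<bar>y - x\<bar> \<le> diameter S"
        using diameter_bounded_bound[OF assms _ x] by (simp add: dist_real_def)
      then show "y \<le> x + diameter S" by simp
    qed
    moreover have "x \<le> Sup S" using x assms by (simp add: bounded_imp_bdd_above cSup_upper)
    ultimately show "x \<in> {Sup S - diameter S..Sup S}" by simp
  qed
  then show thesis using that[of "Sup S - diameter S"] by simp
qed simp

lemma sum_half_powers_le: "0 \<le> e \<Longrightarrow> (\<Sum>i<m. e / 2 ^ Suc i) \<le> (e::real)"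
proof -
  assume "0 \<le> e"
  have "(\<Sum>i<m. e / 2 ^ Suc i) = e - e / 2 ^ m" by (induction m) (auto simp: field_simps)
  then show ?thesis using \<open>0 \<le> e\<close> by simp
qed

text \<open>The number of covering intervals used at grid size \<open>m\<close>: it tends to infinity, and yet the total
  rounding error of that many intervals vanishes in the limit.\<close>

lemma slow_index:
  fixes s :: real
  assumes "0 < s"
  obtains K :: "nat \<Rightarrow> nat"
  where "filterlim K at_top at_top" "(\<lambda>m. real (K m) * (1 / real m) powr s) \<longlonglongrightarrow> 0"
proof
  \<comment> \<open>The exponent \<open>s / 2\<close> leaves a total error of order \<open>m powr (- s / 2)\<close>.\<close>
  let ?K = "\<lambda>m::nat. nat \<lfloor>real m powr (s / 2)\<rfloor>"
  have lim: "(\<lambda>m::nat. real m powr (- s / 2)) \<longlonglongrightarrow> 0"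
    using assms by (intro tendsto_neg_powr filterlim_real_sequentially) simp
  have "\<forall>\<^sub>F m in sequentially. 0 < real m powr (- s / 2)"
    using eventually_gt_at_top[of 0] by eventually_elim simp
  from filterlim_inverse_at_top[OF lim this]
  have "filterlim (\<lambda>m::nat. real m powr (s / 2)) at_top at_top"
    by (simp add: powr_minus[symmetric])
  then have "filterlim (\<lambda>m::nat. \<lfloor>real m powr (s / 2)\<rfloor>) at_top at_top"
    by (rule filterlim_compose[OF filterlim_floor_sequentially])
  then show "filterlim ?K at_top at_top"
    by (rule filterlim_compose[OF filterlim_nat_sequentially])
  show "(\<lambda>m. real (?K m) * (1 / real m) powr s) \<longlonglongrightarrow> 0"
  proof (rule tendsto_sandwich[OF _ _ tendsto_const lim])
    show "\<forall>\<^sub>F m in sequentially. real (?K m) * (1 / real m) powr s \<le> real m powr (- s / 2)"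
      using eventually_gt_at_top[of 0]
    proof eventually_elim
      case (elim m)
      have "real (?K m) * (1 / real m) powr s \<le> real m powr (s / 2) * (1 / real m) powr s"
        by (intro mult_right_mono) (simp_all add: of_nat_nat)
      also have "\<dots> = real m powr (s / 2) * real m powr (- s)"
        using elim by (simp add: powr_divide powr_minus_divide)
      also have "\<dots> = real m powr (- s / 2)" by (simp add: powr_add[symmetric])
      finally show ?case .
    qed
  qed simp
qed

text \<open>If \<open>x\<close> is infinitely close to a point of the \<open>i\<close>th open interval then it lies in the extension
  of that interval, and \<open>i < K N\<close> because \<open>K N\<close> is infinite; so the union over \<open>i < K N\<close> contains
  every monad of a point of \<open>A\<close>. The gap between \<open>\<delta>'\<close> and \<open>\<delta>\<close> makes room for the enlargement and for
  the rounding.\<close>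

lemma internal_superset_of_cover:
  fixes C :: "nat \<Rightarrow> real set"
  assumes U: "nonprincipal_ultrafilter U" and n: "filterlim n at_top U"
    and s: "0 < s" "s \<le> 1" and \<delta>: "\<delta>' < \<delta>"
    and cov: "A \<subseteq> (\<Union>i. C i)" and C: "\<And>i. bounded (C i) \<and> diameter (C i) \<le> \<delta>'"
    and r: "(\<Sum>i. ereal (diameter (C i) powr s)) < ereal r"
  obtains B where "\<forall>k. B k \<subseteq> grid (n k)"
    and "st_preimage U (hclass U n) A \<subseteq> hext U (hclass U B)"
    and "\<forall>\<^sub>F k in U. discrete_h s (n k) \<delta> (B k) \<le> ereal r"
proof -
  define D where "D i = diameter (C i)" for i
  have D: "0 \<le> D i" "D i \<le> \<delta>'" for i using C by (auto simp: D_def diameter_ge_0)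
  obtain r0 where r0: "(\<Sum>i. ereal (D i powr s)) < ereal r0" "r0 < r"
    using ereal_dense2[OF r] by (auto simp: D_def)
  have partial: "(\<Sum>i<m. D i powr s) \<le> r0" for m
  proof -
    have "ereal (\<Sum>i<m. D i powr s) = (\<Sum>i<m. ereal (D i powr s))" by simp
    also have "\<dots> \<le> (\<Sum>i. ereal (D i powr s))"
      by (rule sum_le_suminf) (simp_all add: summable_ereal_pos)
    also have "\<dots> \<le> ereal r0" using r0(1) by simp
    finally show ?thesis by simp
  qed
  define e where "e = (r - r0) / 2"
  define \<gamma> where "\<gamma> = (\<delta> - \<delta>') / 2"
  have e: "0 < e" and \<gamma>: "0 < \<gamma>" using r0 \<delta> by (auto simp: e_def \<gamma>_def)
  \<comment> \<open>The summable allowance \<open>e / 2 ^ Suc i\<close> for the enlargement, converted into a length.\<close>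
  define t where "t i = min \<gamma> ((e / 2 ^ Suc i) powr (1 / s))" for i
  have t: "0 < t i" "t i \<le> \<gamma>" for i using e \<gamma> by (auto simp: t_def)
  have ts: "t i powr s \<le> e / 2 ^ Suc i" for i
  proof -
    have "t i powr s \<le> ((e / 2 ^ Suc i) powr (1 / s)) powr s"
      using t[of i] s by (intro powr_mono2) (auto simp: t_def)
    also have "\<dots> = e / 2 ^ Suc i" using e s by (simp add: powr_powr)
    finally show ?thesis .
  qed
  have "\<exists>l. C i \<subseteq> {l..l + D i}" for i
    using bounded_real_set_in_interval[of "C i"] C[of i] unfolding D_def by blast
  then obtain l where l: "\<And>i. C i \<subseteq> {l i..l i + D i}" by metis
  define I where "I i = {l i - t i / 2<..<l i + D i + t i / 2}" for i
  obtain K where K: "filterlim K at_top at_top" "(\<lambda>m. real (K m) * (1 / real m) powr s) \<longlonglongrightarrow> 0"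
    using slow_index[OF s(1)] .
  define B where "B k = (\<Union>i<K (n k). grid (n k) \<inter> I i)" for k
  show thesis
  proof (rule that)
    show "\<forall>k. B k \<subseteq> grid (n k)" by (auto simp: B_def)
    show "st_preimage U (hclass U n) A \<subseteq> hext U (hclass U B)"
    proof
      fix X assume X: "X \<in> st_preimage U (hclass U n) A"
      then have "X \<in> hyper U" by (simp add: st_preimage_def hext_def)
      then obtain x where x: "X = hclass U x" by (rule hyperE)
      have xg: "\<forall>\<^sub>F k in U. x k \<in> grid (n k)" and "\<exists>a\<in>A. (x \<longlongrightarrow> a) U"
        using X unfolding x hclass_in_st_preimage[OF U] by simp_all
      then obtain a where a: "a \<in> A" "(x \<longlongrightarrow> a) U" by blast
      obtain i where "a \<in> C i" using a cov by blast
      then have "a \<in> {l i..l i + D i}" using l by blast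
      then have "a \<in> I i" using t(1)[of i] by (simp add: I_def)
      moreover have "open (I i)" by (simp add: I_def)
      ultimately have "\<forall>\<^sub>F k in U. x k \<in> I i" using topological_tendstoD[OF a(2)] by blast
      moreover have "\<forall>\<^sub>F k in U. i < K (n k)"
        using eventually_compose_filterlim[OF eventually_gt_at_top filterlim_compose[OF K(1) n]] .
      ultimately have "\<forall>\<^sub>F k in U. x k \<in> B k" using xg
        by eventually_elim (auto simp: B_def)
      then show "X \<in> hext U (hclass U B)" by (simp add: x hclass_in_hext)
    qed
    have "\<forall>\<^sub>F k in U. 0 < n k"
      by (rule eventually_compose_filterlim[OF eventually_gt_at_top n])
    moreover have "\<forall>\<^sub>F k in U. 1 / real (n k) < \<gamma>"
      using order_tendstoD(2)[OF filterlim_compose[OF lim_1_over_n n] \<gamma>] .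
    moreover have "\<forall>\<^sub>F k in U. real (K (n k)) * (1 / real (n k)) powr s < e"
      using order_tendstoD(2)[OF filterlim_compose[OF K(2) n] e] .
    ultimately show "\<forall>\<^sub>F k in U. discrete_h s (n k) \<delta> (B k) \<le> ereal r"
    proof eventually_elim
      case (elim k)
      have "\<exists>a b. grid (n k) \<inter> I i = grid_interval (n k) a b \<and> b \<le> n k \<and>
          (real (Suc b) - real a) / real (n k) \<le> D i + t i + 1 / real (n k)" for i
      proof -
        have "l i - t i / 2 < l i + D i + t i / 2" using D(1)[of i] t(1)[of i] by simp
        from grid_Int_open_interval[OF elim(1) this]
        obtain a b where "grid (n k) \<inter> I i = grid_interval (n k) a b" "b \<le> n k"
          "(real (Suc b) - real a) / real (n k)
             \<le> l i + D i + t i / 2 - (l i - t i / 2) + 1 / real (n k)"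
          unfolding I_def .
        then show ?thesis by (intro exI[of _ a] exI[of _ b]) simp
      qed
      then obtain a b where ab: "\<And>i. grid (n k) \<inter> I i = grid_interval (n k) (a i) (b i)"
        "\<And>i. b i \<le> n k"
        "\<And>i. (real (Suc (b i)) - real (a i)) / real (n k) \<le> D i + t i + 1 / real (n k)" by metis
      have "B k = (\<Union>i\<in>{..<K (n k)}. grid_interval (n k) (a i) (b i))"
        unfolding B_def ab(1) ..
      moreover have "discrete_h s (n k) \<delta> (\<Union>i\<in>{..<K (n k)}. grid_interval (n k) (a i) (b i))
          \<le> ereal (\<Sum>i<K (n k). (D i + t i + 1 / real (n k)) powr s)"
      proof (rule discrete_h_le_sum[OF elim(1) _ ab(2,3) _ s(1)])
        show "0 \<le> D i + t i + 1 / real (n k) \<and> D i + t i + 1 / real (n k) \<le> \<delta>" for i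
          using D[of i] t[of i] elim(2) by (simp add: \<gamma>_def field_simps)
      qed simp
      moreover have "(\<Sum>i<K (n k). (D i + t i + 1 / real (n k)) powr s) \<le> r"
      proof -
        have "(D i + t i + 1 / real (n k)) powr s \<le> D i powr s + e / 2 ^ Suc i + (1 / real (n k)) powr s" for i
          using powr_subadditive[of "D i + t i" "1 / real (n k)" s] powr_subadditive[of "D i" "t i" s]
            ts[of i] t(1)[of i] D(1)[of i] s by simp
        then have "(\<Sum>i<K (n k). (D i + t i + 1 / real (n k)) powr s)
            \<le> (\<Sum>i<K (n k). D i powr s + e / 2 ^ Suc i + (1 / real (n k)) powr s)"
          by (intro sum_mono) simp
        also have "\<dots> = (\<Sum>i<K (n k). D i powr s) + (\<Sum>i<K (n k). e / 2 ^ Suc i) +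
            real (K (n k)) * (1 / real (n k)) powr s"
          by (simp add: sum.distrib)
        also have "\<dots> \<le> r0 + e + e"
          using partial sum_half_powers_le[of e] e elim(3) by (intro add_mono) simp_all
        also have "\<dots> = r" by (simp add: e_def field_simps)
        finally show ?thesis .
      qed
      ultimately show ?case by (metis ereal_less_eq(3) order_trans)
    qed
  qed
qed

lemma inf_st_h_le_hausdorff_delta:
  assumes U: "nonprincipal_ultrafilter U" and n: "filterlim n at_top U"
    and s: "0 < s" "s \<le> 1" and \<delta>: "\<delta>' < \<delta>"
  shows "inf_st_h U s (hclass U n) (hstd U \<delta>) A \<le> hausdorff_delta s \<delta>' A"
  unfolding hausdorff_delta_def
proof (rule Inf_greatest)
  fix S assume "S \<in> {(\<Sum>i. ereal (diameter (C i) powr s)) | C. A \<subseteq> (\<Union>i. C i) \<and>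
      (\<forall>i. bounded (C i) \<and> diameter (C i) \<le> \<delta>')}"
  then obtain C where S: "S = (\<Sum>i. ereal (diameter (C i) powr s))" and cov: "A \<subseteq> (\<Union>i. C i)"
    and C: "\<And>i. bounded (C i) \<and> diameter (C i) \<le> \<delta>'" by blast
  have "inf_st_h U s (hclass U n) (hstd U \<delta>) A \<le> ereal r" if r: "S < ereal r" for r
  proof -
    obtain B where B: "\<forall>k. B k \<subseteq> grid (n k)"
      "st_preimage U (hclass U n) A \<subseteq> hext U (hclass U B)"
      "\<forall>\<^sub>F k in U. discrete_h s (n k) \<delta> (B k) \<le> ereal r"
      using internal_superset_of_cover[OF U n s \<delta> cov C r[unfolded S]] .
    have h: "hdiscrete_h U s (hclass U n) (hstd U \<delta>) (hclass U B) =
        hclass U (\<lambda>k. discrete_h s (n k) \<delta> (B k))"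
      by (simp add: hdiscrete_h_def hstd_def happ_hclass)
    have "hext U (hclass U B) \<subseteq> hext U (Omega U (hclass U n))"
    proof
      fix X assume X: "X \<in> hext U (hclass U B)"
      then have "X \<in> hyper U" by (simp add: hext_def)
      then obtain x where x: "X = hclass U x" by (rule hyperE)
      show "X \<in> hext U (Omega U (hclass U n))"
        using X B(1) unfolding x Omega_def hstd_def happ_hclass hclass_in_hext
        by (auto elim!: eventually_mono)
    qed
    then have "inf_st_h U s (hclass U n) (hstd U \<delta>) A
        \<le> st U (hdiscrete_h U s (hclass U n) (hstd U \<delta>) (hclass U B))"
      unfolding inf_st_h_def using B(2) hclass_in_hyper[of U B] by (intro Inf_lower) blast
    also have "\<dots> \<le> ereal r"
      unfolding h by (rule tendsto_upperbound[OF st_limit[OF U] B(3) ultrafilter_ne_bot[OF U]])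
    finally show ?thesis .
  qed
  then show "inf_st_h U s (hclass U n) (hstd U \<delta>) A \<le> S" by (rule ereal_le_if_le_reals_above)
qed

section \<open>The Hausdorff measure as a limit\<close>

lemma hausdorff_delta_antimono:
  fixes A :: "'a::metric_space set"
  assumes "\<delta> \<le> \<delta>'"
  shows "hausdorff_delta s \<delta>' A \<le> hausdorff_delta s \<delta> A"
proof -
  have "diameter (C i) \<le> \<delta>'" if "\<forall>i. bounded (C i) \<and> diameter (C i) \<le> \<delta>" for C :: "nat \<Rightarrow> 'a set" and i
    using that assms order_trans by blast
  then show ?thesis unfolding hausdorff_delta_def by (intro Inf_superset_mono) blast
qed

lemma hausdorff_delta_le_outer: "0 < \<delta> \<Longrightarrow> hausdorff_delta s \<delta> A \<le> hausdorff_outer s A"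
  unfolding hausdorff_outer_def by (rule SUP_upper) simp

lemma hausdorff_delta_tendsto_outer:
  "((\<lambda>\<delta>. hausdorff_delta s \<delta> A) \<longlongrightarrow> hausdorff_outer s A) (at_right 0)"
proof (rule order_tendstoI)
  fix a assume "a < hausdorff_outer s A"
  then obtain \<delta>0 where \<delta>0: "0 < \<delta>0" "a < hausdorff_delta s \<delta>0 A"
    by (auto simp: hausdorff_outer_def less_SUP_iff)
  have "\<forall>\<^sub>F \<delta> in at_right 0. \<delta> \<in> {0<..<\<delta>0}"
    using \<delta>0(1) by (rule eventually_at_right_real)
  then show "\<forall>\<^sub>F \<delta> in at_right 0. a < hausdorff_delta s \<delta> A"
  proof eventually_elim
    case (elim \<delta>)
    then have "hausdorff_delta s \<delta>0 A \<le> hausdorff_delta s \<delta> A"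
      by (intro hausdorff_delta_antimono) simp
    with \<delta>0(2) show ?case by (rule less_le_trans)
  qed
next
  fix a assume a: "hausdorff_outer s A < a"
  have "\<forall>\<^sub>F \<delta> in at_right 0. (0::real) < \<delta>" by (simp add: eventually_at_right_less)
  then show "\<forall>\<^sub>F \<delta> in at_right 0. hausdorff_delta s \<delta> A < a"
    by eventually_elim (rule le_less_trans[OF hausdorff_delta_le_outer a])
qed

lemma inf_st_h_tendsto_outer:
  assumes U: "nonprincipal_ultrafilter U" and N: "infinite_hypernat U N"
    and A: "A \<subseteq> {0..1}" and s: "0 < s" "s \<le> 1"
  shows "((\<lambda>\<delta>. inf_st_h U s N (hstd U \<delta>) A) \<longlongrightarrow> hausdorff_outer s A) (at_right 0)"
proof -
  have "N \<in> hyper U" using N by (simp add: infinite_hypernat_def)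
  then obtain n where N': "N = hclass U n" by (rule hyperE)
  have n: "filterlim n at_top U" using N infinite_hypernat_iff[OF U] unfolding N' by blast
  have pos: "\<forall>\<^sub>F \<delta> in at_right 0. (0::real) < \<delta>" by (simp add: eventually_at_right_less)
  show ?thesis
  proof (rule tendsto_sandwich[OF _ _ hausdorff_delta_tendsto_outer tendsto_const])
    show "\<forall>\<^sub>F \<delta> in at_right 0. hausdorff_delta s \<delta> A \<le> inf_st_h U s N (hstd U \<delta>) A"
      using pos
    proof eventually_elim
      case (elim \<delta>)
      show ?case unfolding N' hstd_def
        by (rule hausdorff_delta_le_inf_st_h[OF U n A s elim]) simp
    qed
    show "\<forall>\<^sub>F \<delta> in at_right 0. inf_st_h U s N (hstd U \<delta>) A \<le> hausdorff_outer s A"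
      using pos
    proof eventually_elim
      case (elim \<delta>)
      have "inf_st_h U s N (hstd U \<delta>) A \<le> hausdorff_delta s (\<delta> / 2) A"
        unfolding N' using elim by (intro inf_st_h_le_hausdorff_delta[OF U n s]) simp
      also have "\<dots> \<le> hausdorff_outer s A" using elim by (intro hausdorff_delta_le_outer) simp
      finally show ?case .
    qed
  qed
qed

lemma hausdorff_outer_le_inf_st_h:
  assumes U: "nonprincipal_ultrafilter U" and N: "infinite_hypernat U N"
    and A: "A \<subseteq> {0..1}" and s: "0 < s" "s \<le> 1"
    and \<delta>: "\<delta> \<in> hyper U" "infinitesimal U \<delta>"
  shows "hausdorff_outer s A \<le> inf_st_h U s N \<delta> A"
  unfolding hausdorff_outer_def
proof (rule SUP_least)
  fix \<delta>0 :: real assume "\<delta>0 \<in> {0<..}"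
  then have pos: "0 < \<delta>0" by simp
  have "N \<in> hyper U" using N by (simp add: infinite_hypernat_def)
  then obtain n where N': "N = hclass U n" by (rule hyperE)
  have n: "filterlim n at_top U" using N infinite_hypernat_iff[OF U] unfolding N' by blast
  obtain d where d: "\<delta> = hclass U d" using \<delta>(1) by (rule hyperE)
  have "\<forall>\<^sub>F k in U. \<bar>d k\<bar> < \<delta>0"
    using \<delta>(2) pos unfolding infinitesimal_def d hstd_def happ_hclass hrel_hclass by blast
  then have "\<forall>\<^sub>F k in U. d k \<le> \<delta>0" by eventually_elim simp
  then show "hausdorff_delta s \<delta>0 A \<le> inf_st_h U s N \<delta> A"
    unfolding N' d by (rule hausdorff_delta_le_inf_st_h[OF U n A s pos])
qed

theorem theorem5p2p2:
  fixes U :: "nat filter" and N :: "nat hyp" and A :: "real set" and s :: real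
  assumes "nonprincipal_ultrafilter U"
    and "infinite_hypernat U N"
    and "A \<subseteq> {0..1}"
    and "0 < s" and "s \<le> 1"
  shows "(\<forall>\<delta>\<in>hyper U. hless U (hstd U 0) \<delta> \<longrightarrow> infinitesimal U \<delta> \<longrightarrow>
            hausdorff_outer s A \<le> inf_st_h U s N \<delta> A)
    \<and> ((\<lambda>\<delta>. inf_st_h U s N (hstd U \<delta>) A) \<longlongrightarrow> hausdorff_outer s A) (at_right 0)
    \<and> (\<forall>M. infinite_hypernat U M \<longrightarrow>
          Lim (at_right 0) (\<lambda>\<delta>. inf_st_h U s M (hstd U \<delta>) A) =
          Lim (at_right 0) (\<lambda>\<delta>. inf_st_h U s N (hstd U \<delta>) A))"
proof (intro conjI ballI allI impI)
  show "hausdorff_outer s A \<le> inf_st_h U s N \<delta> A" if "\<delta> \<in> hyper U" "infinitesimal U \<delta>" for \<delta>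
    using hausdorff_outer_le_inf_st_h[OF assms that] .
  have lim: "((\<lambda>\<delta>. inf_st_h U s M (hstd U \<delta>) A) \<longlongrightarrow> hausdorff_outer s A) (at_right 0)"
    if "infinite_hypernat U M" for M
    using inf_st_h_tendsto_outer[OF assms(1) that assms(3-5)] .
  then show "((\<lambda>\<delta>. inf_st_h U s N (hstd U \<delta>) A) \<longlongrightarrow> hausdorff_outer s A) (at_right 0)"
    using assms(2) .
  show "Lim (at_right 0) (\<lambda>\<delta>. inf_st_h U s M (hstd U \<delta>) A) =
      Lim (at_right 0) (\<lambda>\<delta>. inf_st_h U s N (hstd U \<delta>) A)" if "infinite_hypernat U M" for M
    using tendsto_Lim[OF trivial_limit_at_right_real lim[OF that]]
      tendsto_Lim[OF trivial_limit_at_right_real lim[OF assms(2)]] by simp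
qed

end
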